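(* Let $R$ be a finite commutative ring. The categories $\mathbf{VI}_R$ and $\mathbf{VA}_R$ are quasi-Gröbner.
   Context: A linear map between free $R$-modules is splittable if its image is a direct summand (of the target). $\mathbf{VA}_R$ (resp. $\mathbf{VI}_R$) is the category whose objects are finite rank free $R$-modules and whose morphisms are the splittable maps (resp. the splittable injections). For an essentially small category $\mathcal{C}$ and object $x$, let $S_x(y)=\mathrm{Hom}(x,y)$. $\mathcal{C}$ is Gröbner if for every object $x$: (1) there are well-orders on all the sets $S_x(y)$ such that every postcomposition map $S_x(y)\to S_x(z)$ is strictly order-preserving; and (2) the poset $|S_x|$ is noetherian, i.e. every infinite sequence $x_1,x_2,\dots$ in it has $i<j$ with $x_i\le x_j$. Here $|S_x|$ is the quotient of the collection of all morphisms out of $x$, preordered by $f\le g$ iff $g=hf$ for some $h$, by the equivalence relation identifying $f$ and $g$ when $f\le g$ and $g\le f$. A functor $\Phi\colon\mathcal{C}'\to\mathcal{C}$ satisfies property (F) if for every object $x$ of $\mathcal{C}$ there exist finitely many objects $y_1,\dots,y_n$ of $\mathcal{C}'$ and morphisms $f_i\colon x\to\Phi(y_i)$ in $\mathcal{C}$ such that for every object $y$ of $\mathcal{C}'$ and every morphism $f\colon x\to\Phi(y)$ in $\mathcal{C}$ there exist $i$ and a morphism $g\colon y_i\to y$ in $\mathcal{C}'$ with $f=\Phi(g)\circ f_i$. $\mathcal{C}$ is quasi-Gröbner if there exist a Gröbner category $\mathcal{C}'$ and an essentially surjective functor $\mathcal{C}'\to\mathcal{C}$ satisfying property (F).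
   Formalization: Splittable maps need not compose (over Z/4, a↦(a,2a) then (a,b)↦b is multiplication by 2), so VA_R need not be a category; the quasi-Gröbner conditions are proved for it without requiring closure under composition. *)

theory Defs
  imports "HOL-Algebra.Module" "HOL-Algebra.AbelCoset" "HOL-Library.FuncSet"
begin

section \<open>Categories\<close>

text \<open>
  Morphism sets are indexed by source and target and need not be disjoint, so composition and
  identities take the objects as arguments: \<open>Cmp C x y z g f\<close> is $g \circ f$ for
  $f \colon x \to y$ and $g \colon y \to z$. The object collection is a HOL set, so every
  category considered here is small.
\<close>

record ('o, 'm) cat =
  Ob :: "'o set"
  Mor :: "'o \<Rightarrow> 'o \<Rightarrow> 'm set"
  Cmp :: "'o \<Rightarrow> 'o \<Rightarrow> 'o \<Rightarrow> 'm \<Rightarrow> 'm \<Rightarrow> 'm"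
  Idm :: "'o \<Rightarrow> 'm"

locale category =
  fixes C :: "('o, 'm) cat"
  assumes Idm_in: "x \<in> Ob C \<Longrightarrow> Idm C x \<in> Mor C x x"
    and Cmp_in: "\<lbrakk>x \<in> Ob C; y \<in> Ob C; z \<in> Ob C; f \<in> Mor C x y; g \<in> Mor C y z\<rbrakk>
      \<Longrightarrow> Cmp C x y z g f \<in> Mor C x z"
    and Cmp_Idm: "\<lbrakk>x \<in> Ob C; y \<in> Ob C; f \<in> Mor C x y\<rbrakk> \<Longrightarrow> Cmp C x x y f (Idm C x) = f"
    and Idm_Cmp: "\<lbrakk>x \<in> Ob C; y \<in> Ob C; f \<in> Mor C x y\<rbrakk> \<Longrightarrow> Cmp C x y y (Idm C y) f = f"
    and Cmp_assoc: "\<lbrakk>w \<in> Ob C; x \<in> Ob C; y \<in> Ob C; z \<in> Ob C;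
        f \<in> Mor C w x; g \<in> Mor C x y; h \<in> Mor C y z\<rbrakk>
      \<Longrightarrow> Cmp C w y z h (Cmp C w x y g f) = Cmp C w x z (Cmp C x y z h g) f"

definition iso_objects :: "('o, 'm) cat \<Rightarrow> 'o \<Rightarrow> 'o \<Rightarrow> bool" where
  "iso_objects C x y \<longleftrightarrow> (\<exists>f \<in> Mor C x y. \<exists>g \<in> Mor C y x.
     Cmp C x y x g f = Idm C x \<and> Cmp C y x y f g = Idm C y)"

definition is_functor ::
  "('p, 'n) cat \<Rightarrow> ('o, 'm) cat \<Rightarrow> ('p \<Rightarrow> 'o) \<Rightarrow> ('p \<Rightarrow> 'p \<Rightarrow> 'n \<Rightarrow> 'm) \<Rightarrow> bool" where
  "is_functor D C F \<Phi> \<longleftrightarrow>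
     (\<forall>x \<in> Ob D. F x \<in> Ob C) \<and>
     (\<forall>x \<in> Ob D. \<forall>y \<in> Ob D. \<forall>f \<in> Mor D x y. \<Phi> x y f \<in> Mor C (F x) (F y)) \<and>
     (\<forall>x \<in> Ob D. \<Phi> x x (Idm D x) = Idm C (F x)) \<and>
     (\<forall>x \<in> Ob D. \<forall>y \<in> Ob D. \<forall>z \<in> Ob D. \<forall>f \<in> Mor D x y. \<forall>g \<in> Mor D y z.
        \<Phi> x z (Cmp D x y z g f) = Cmp C (F x) (F y) (F z) (\<Phi> y z g) (\<Phi> x y f))"

definition essentially_surjective :: "('p, 'n) cat \<Rightarrow> ('o, 'm) cat \<Rightarrow> ('p \<Rightarrow> 'o) \<Rightarrow> bool" where
  "essentially_surjective D C F \<longleftrightarrow> (\<forall>x \<in> Ob C. \<exists>y \<in> Ob D. iso_objects C x (F y))"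


section \<open>Groebner and quasi-Groebner categories\<close>

text \<open>Morphisms out of \<open>x\<close>, each recorded together with its target.\<close>

definition out_mor :: "('o, 'm) cat \<Rightarrow> 'o \<Rightarrow> ('o \<times> 'm) set" where
  "out_mor C x = (SIGMA y : Ob C. Mor C x y)"

definition out_le :: "('o, 'm) cat \<Rightarrow> 'o \<Rightarrow> 'o \<times> 'm \<Rightarrow> 'o \<times> 'm \<Rightarrow> bool" where
  "out_le C x p q \<longleftrightarrow>
     (case p of (y, f) \<Rightarrow> case q of (z, g) \<Rightarrow> \<exists>h \<in> Mor C y z. g = Cmp C x y z h f)"

definition out_equiv :: "('o, 'm) cat \<Rightarrow> 'o \<Rightarrow> (('o \<times> 'm) \<times> ('o \<times> 'm)) set" where
  "out_equiv C x =
     {(p, q). p \<in> out_mor C x \<and> q \<in> out_mor C x \<and> out_le C x p q \<and> out_le C x q p}"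

text \<open>The poset $|S_x|$: its underlying set and its order.\<close>

definition out_poset :: "('o, 'm) cat \<Rightarrow> 'o \<Rightarrow> ('o \<times> 'm) set set" where
  "out_poset C x = out_mor C x // out_equiv C x"

definition out_poset_le ::
  "('o, 'm) cat \<Rightarrow> 'o \<Rightarrow> ('o \<times> 'm) set \<Rightarrow> ('o \<times> 'm) set \<Rightarrow> bool" where
  "out_poset_le C x P Q \<longleftrightarrow> (\<exists>p \<in> P. \<exists>q \<in> Q. out_le C x p q)"

definition noetherian_poset :: "'a set \<Rightarrow> ('a \<Rightarrow> 'a \<Rightarrow> bool) \<Rightarrow> bool" where
  "noetherian_poset A leq \<longleftrightarrow>
     (\<forall>s :: nat \<Rightarrow> 'a. (\<forall>n. s n \<in> A) \<longrightarrow> (\<exists>i j. i < j \<and> leq (s i) (s j)))"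

definition well_orderable_out :: "('o, 'm) cat \<Rightarrow> 'o \<Rightarrow> bool" where
  "well_orderable_out C x \<longleftrightarrow> (\<exists>r :: 'o \<Rightarrow> 'm rel.
     (\<forall>y \<in> Ob C. well_order_on (Mor C x y) (r y)) \<and>
     (\<forall>y \<in> Ob C. \<forall>z \<in> Ob C. \<forall>h \<in> Mor C y z. \<forall>f \<in> Mor C x y. \<forall>g \<in> Mor C x y.
        (f, g) \<in> r y \<and> f \<noteq> g \<longrightarrow>
        (Cmp C x y z h f, Cmp C x y z h g) \<in> r z \<and> Cmp C x y z h f \<noteq> Cmp C x y z h g))"

definition groebner :: "('o, 'm) cat \<Rightarrow> bool" where
  "groebner C \<longleftrightarrow> category C \<and>
     (\<forall>x \<in> Ob C. well_orderable_out C x \<and> noetherian_poset (out_poset C x) (out_poset_le C x))"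

definition property_F ::
  "('p, 'n) cat \<Rightarrow> ('o, 'm) cat \<Rightarrow> ('p \<Rightarrow> 'o) \<Rightarrow> ('p \<Rightarrow> 'p \<Rightarrow> 'n \<Rightarrow> 'm) \<Rightarrow> bool" where
  "property_F D C F \<Phi> \<longleftrightarrow> (\<forall>x \<in> Ob C. \<exists>(n :: nat) (ys :: nat \<Rightarrow> 'p) (fs :: nat \<Rightarrow> 'm).
     (\<forall>i<n. ys i \<in> Ob D \<and> fs i \<in> Mor C x (F (ys i))) \<and>
     (\<forall>y \<in> Ob D. \<forall>f \<in> Mor C x (F y). \<exists>i<n. \<exists>g \<in> Mor D (ys i) y.
        f = Cmp C x (F (ys i)) (F y) (\<Phi> (ys i) y g) (fs i)))"

text \<open>
  HOL cannot quantify over the types of the auxiliary category \<open>D\<close>, so they are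
  parameters; a smaller choice of types makes the predicate stronger.
  That \<open>C\<close> itself is a category is deliberately not part of the predicate, see the remark
  on \<open>VA\<close> below.
\<close>

definition quasi_groebner :: "'p itself \<Rightarrow> 'n itself \<Rightarrow> ('o, 'm) cat \<Rightarrow> bool" where
  "quasi_groebner ob_type mor_type C \<longleftrightarrow>
     (\<exists>(D :: ('p, 'n) cat) F \<Phi>. groebner D \<and> is_functor D C F \<Phi> \<and>
        essentially_surjective D C F \<and> property_F D C F \<Phi>)"


section \<open>Free modules and splittable maps\<close>

definition is_basis :: "('a, 'r) ring_scheme \<Rightarrow> ('a, 'b) module \<Rightarrow> 'b set \<Rightarrow> bool" where
  "is_basis R M B \<longleftrightarrow> B \<subseteq> carrier M \<and>
     (\<forall>v \<in> carrier M. \<exists>!c. c \<in> B \<rightarrow>\<^sub>E carrier R \<and> v = (\<Oplus>\<^bsub>M\<^esub> b \<in> B. c b \<odot>\<^bsub>M\<^esub> b))"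

definition free_finite_rank :: "('a, 'r) ring_scheme \<Rightarrow> ('a, 'b) module \<Rightarrow> bool" where
  "free_finite_rank R M \<longleftrightarrow> module R M \<and> (\<exists>B. finite B \<and> is_basis R M B)"

text \<open>Maps are undefined off the carrier of the source, so that equal maps are equal in HOL.\<close>

definition linear_maps ::
  "('a, 'r) ring_scheme \<Rightarrow> ('a, 'b) module \<Rightarrow> ('a, 'b) module \<Rightarrow> ('b \<Rightarrow> 'b) set" where
  "linear_maps R M N = {f \<in> carrier M \<rightarrow>\<^sub>E carrier N.
     (\<forall>u \<in> carrier M. \<forall>v \<in> carrier M. f (u \<oplus>\<^bsub>M\<^esub> v) = f u \<oplus>\<^bsub>N\<^esub> f v) \<and>
     (\<forall>a \<in> carrier R. \<forall>v \<in> carrier M. f (a \<odot>\<^bsub>M\<^esub> v) = a \<odot>\<^bsub>N\<^esub> f v)}"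

definition direct_summand :: "('a, 'r) ring_scheme \<Rightarrow> ('a, 'b) module \<Rightarrow> 'b set \<Rightarrow> bool" where
  "direct_summand R N H \<longleftrightarrow> submodule H R N \<and>
     (\<exists>K. submodule K R N \<and> H \<inter> K = {\<zero>\<^bsub>N\<^esub>} \<and> H <+>\<^bsub>N\<^esub> K = carrier N)"

definition splittable_maps ::
  "('a, 'r) ring_scheme \<Rightarrow> ('a, 'b) module \<Rightarrow> ('a, 'b) module \<Rightarrow> ('b \<Rightarrow> 'b) set" where
  "splittable_maps R M N = {f \<in> linear_maps R M N. direct_summand R N (f ` carrier M)}"

text \<open>
  The objects are the finite rank free modules with elements in the type \<open>'b\<close>. Over a finite ring
  these modules are finite, so every one of them occurs up to isomorphism once \<open>'b\<close> is infinite.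

  \<open>VA\<close> is taken literally, with exactly the splittable maps as morphisms. \<open>VI\<close> is a category
  (lemma \<open>category_VI\<close>), but splittable maps need not compose: over the integers
  modulo $4$, the split injection $a \mapsto (a, 2a)$ followed by the second projection is
  multiplication by $2$, whose image is not a direct summand. So \<open>VA\<close> is a category exactly when
  the splittable maps over the ring are closed under composition (lemma \<open>category_VA_iff\<close>). The
  conditions defining \<open>quasi_groebner\<close> do not refer to this closure and make sense in any case.
\<close>

definition VA :: "('a, 'r) ring_scheme \<Rightarrow> (('a, 'b) module, 'b \<Rightarrow> 'b) cat" where
  "VA R = \<lparr>Ob = {M. free_finite_rank R M},
     Mor = splittable_maps R,
     Cmp = (\<lambda>L M N g f. compose (carrier L) g f),
     Idm = (\<lambda>M. restrict id (carrier M))\<rparr>"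

definition VI :: "('a, 'r) ring_scheme \<Rightarrow> (('a, 'b) module, 'b \<Rightarrow> 'b) cat" where
  "VI R = \<lparr>Ob = {M. free_finite_rank R M},
     Mor = (\<lambda>M N. {f \<in> splittable_maps R M N. inj_on f (carrier M)}),
     Cmp = (\<lambda>L M N g f. compose (carrier L) g f),
     Idm = (\<lambda>M. restrict id (carrier M))\<rparr>"

lemma linear_mapsD:
  assumes "f \<in> linear_maps R M N"
  shows "f \<in> carrier M \<rightarrow>\<^sub>E carrier N"
    and "\<And>v. v \<in> carrier M \<Longrightarrow> f v \<in> carrier N"
    and "\<And>u v. u \<in> carrier M \<Longrightarrow> v \<in> carrier M \<Longrightarrow> f (u \<oplus>\<^bsub>M\<^esub> v) = f u \<oplus>\<^bsub>N\<^esub> f v"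
    and "\<And>a v. a \<in> carrier R \<Longrightarrow> v \<in> carrier M \<Longrightarrow> f (a \<odot>\<^bsub>M\<^esub> v) = a \<odot>\<^bsub>N\<^esub> f v"
  using assms by (auto simp: linear_maps_def)

lemma linear_maps_compose:
  assumes "module R L" "f \<in> linear_maps R L M" "g \<in> linear_maps R M N"
  shows "compose (carrier L) g f \<in> linear_maps R L N"
proof -
  interpret L: module R L by fact
  note f = linear_mapsD[OF assms(2)] and g = linear_mapsD[OF assms(3)]
  show ?thesis
    unfolding linear_maps_def by (auto simp: compose_def f g)
qed

lemma linear_maps_zero:
  assumes "module R M" "module R N" "f \<in> linear_maps R M N"
  shows "f \<zero>\<^bsub>M\<^esub> = \<zero>\<^bsub>N\<^esub>"
proof -
  interpret M: module R M by fact
  interpret N: module R N by fact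
  note f = linear_mapsD[OF assms(3)]
  have "f \<zero>\<^bsub>M\<^esub> = f (\<zero>\<^bsub>R\<^esub> \<odot>\<^bsub>M\<^esub> \<zero>\<^bsub>M\<^esub>)"
    by simp
  also have "\<dots> = \<zero>\<^bsub>N\<^esub>"
    using f(4)[of "\<zero>\<^bsub>R\<^esub>" "\<zero>\<^bsub>M\<^esub>"] f(2)[of "\<zero>\<^bsub>M\<^esub>"] by simp
  finally show ?thesis .
qed

lemma submodule_image:
  assumes "module R M" "module R N" "f \<in> linear_maps R M N" "submodule H R M"
  shows "submodule (f ` H) R N"
proof -
  interpret M: module R M by fact
  interpret N: module R N by fact
  note f = linear_mapsD[OF assms(3)]
  note H = M.submoduleE[OF assms(4)]
  have z: "\<zero>\<^bsub>M\<^esub> \<in> H"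
    using assms(4) subgroup.one_closed[of H "add_monoid M"] by (simp add: submodule_def)
  have minus: "\<ominus>\<^bsub>N\<^esub> f h = f (\<ominus>\<^bsub>M\<^esub> h)" if "h \<in> carrier M" for h
  proof (rule N.minus_equality)
    have "f (\<ominus>\<^bsub>M\<^esub> h) \<oplus>\<^bsub>N\<^esub> f h = f (\<ominus>\<^bsub>M\<^esub> h \<oplus>\<^bsub>M\<^esub> h)"
      using that by (simp add: f)
    also have "\<dots> = \<zero>\<^bsub>N\<^esub>"
      using that by (simp add: M.l_neg linear_maps_zero[OF assms(1-3)])
    finally show "f (\<ominus>\<^bsub>M\<^esub> h) \<oplus>\<^bsub>N\<^esub> f h = \<zero>\<^bsub>N\<^esub>" .
  qed (use that f in auto)
  show ?thesis
  proof (rule N.submoduleI)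
    show "f ` H \<subseteq> carrier N" using H(1) f(2) by auto
    show "\<zero>\<^bsub>N\<^esub> \<in> f ` H" using z linear_maps_zero[OF assms(1-3)] by (metis image_eqI)
    show "\<And>a. a \<in> f ` H \<Longrightarrow> \<ominus>\<^bsub>N\<^esub> a \<in> f ` H" using minus H(1,3) by auto
    show "\<And>a b. a \<in> f ` H \<Longrightarrow> b \<in> f ` H \<Longrightarrow> a \<oplus>\<^bsub>N\<^esub> b \<in> f ` H"
      using H(1,5) f(3) by (auto simp: image_iff) (metis subsetD)
    show "\<And>a x. a \<in> carrier R \<Longrightarrow> x \<in> f ` H \<Longrightarrow> a \<odot>\<^bsub>N\<^esub> x \<in> f ` H"
      using H(1,4) f(4) by (auto simp: image_iff) (metis subsetD)
  qed
qed

lemma direct_summand_carrier: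
  assumes "module R M"
  shows "direct_summand R M (carrier M)"
proof -
  interpret M: module R M by fact
  have "submodule {\<zero>\<^bsub>M\<^esub>} R M"
    by (rule M.submoduleI) auto
  moreover have "carrier M <+>\<^bsub>M\<^esub> {\<zero>\<^bsub>M\<^esub>} = carrier M"
    by (auto simp: set_add_def' intro!: bexI)
  ultimately show ?thesis
    unfolding direct_summand_def using M.carrier_is_submodule by auto
qed

lemma restrict_id_splittable:
  assumes "module R M"
  shows "restrict id (carrier M) \<in> splittable_maps R M M"
proof -
  interpret M: module R M by fact
  show ?thesis
    using direct_summand_carrier[OF assms]
    by (auto simp: splittable_maps_def linear_maps_def)
qed

lemma direct_summand_image:
  assumes MN: "module R M" "module R N" and g: "g \<in> splittable_maps R M N"
    and inj: "inj_on g (carrier M)" and H: "direct_summand R M H"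
  shows "direct_summand R N (g ` H)"
proof -
  interpret M: module R M by fact
  interpret N: module R N by fact
  have lin: "g \<in> linear_maps R M N" using g by (simp add: splittable_maps_def)
  note gD = linear_mapsD[OF lin]
  obtain K where K: "submodule K R M" "H \<inter> K = {\<zero>\<^bsub>M\<^esub>}" "H <+>\<^bsub>M\<^esub> K = carrier M"
    using H by (auto simp: direct_summand_def)
  have Hs: "submodule H R M" using H by (simp add: direct_summand_def)
  obtain L where L: "submodule L R N" "g ` carrier M \<inter> L = {\<zero>\<^bsub>N\<^esub>}"
      "g ` carrier M <+>\<^bsub>N\<^esub> L = carrier N"
    using g by (auto simp: splittable_maps_def direct_summand_def)
  note HE = M.submoduleE[OF Hs] and KE = M.submoduleE[OF K(1)] and LE = N.submoduleE[OF L(1)]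
  note Ks = submodule_image[OF MN lin K(1)]
  note KsE = N.submoduleE[OF Ks]
  have zK: "\<zero>\<^bsub>M\<^esub> \<in> K" "\<zero>\<^bsub>M\<^esub> \<in> H" using K(2) by auto
  have zL: "\<zero>\<^bsub>N\<^esub> \<in> L" using L(2) by auto
  have g0: "g \<zero>\<^bsub>M\<^esub> = \<zero>\<^bsub>N\<^esub>" by (rule linear_maps_zero[OF MN lin])
  define K' where "K' = g ` K <+>\<^bsub>N\<^esub> L"
  have K'_iff: "x \<in> K' \<longleftrightarrow> (\<exists>k\<in>K. \<exists>l\<in>L. x = g k \<oplus>\<^bsub>N\<^esub> l)" for x
    by (auto simp: K'_def set_add_def')
  have K'I: "k \<oplus>\<^bsub>N\<^esub> l \<in> K'" if "k \<in> g ` K" "l \<in> L" for k l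
    using that by (auto simp: K'_iff)
  have K'sub: "submodule K' R N"
  proof (rule N.submoduleI)
    show "K' \<subseteq> carrier N"
      using KE(1) LE(1) gD(2) by (auto simp: K'_iff subset_iff)
    have "\<zero>\<^bsub>N\<^esub> = g \<zero>\<^bsub>M\<^esub> \<oplus>\<^bsub>N\<^esub> \<zero>\<^bsub>N\<^esub>" by (simp add: g0)
    then show "\<zero>\<^bsub>N\<^esub> \<in> K'" using zK zL unfolding K'_iff by blast
  next
    fix a assume "a \<in> K'"
    then obtain k l where kl: "k \<in> g ` K" "l \<in> L" "a = k \<oplus>\<^bsub>N\<^esub> l" by (auto simp: K'_iff)
    have "k \<in> carrier N" "l \<in> carrier N" using kl KsE(1) LE(1) by auto
    then have "\<ominus>\<^bsub>N\<^esub> a = \<ominus>\<^bsub>N\<^esub> k \<oplus>\<^bsub>N\<^esub> \<ominus>\<^bsub>N\<^esub> l" using kl(3) by (simp add: N.minus_add)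
    moreover have "\<ominus>\<^bsub>N\<^esub> k \<in> g ` K" "\<ominus>\<^bsub>N\<^esub> l \<in> L" using kl KsE(3) LE(3) by auto
    ultimately show "\<ominus>\<^bsub>N\<^esub> a \<in> K'" by (simp add: K'I)
  next
    fix a b assume "a \<in> K'" "b \<in> K'"
    then obtain k l k' l' where kl: "k \<in> g ` K" "l \<in> L" "a = k \<oplus>\<^bsub>N\<^esub> l"
       "k' \<in> g ` K" "l' \<in> L" "b = k' \<oplus>\<^bsub>N\<^esub> l'"
      unfolding K'_iff by blast
    have c: "k \<in> carrier N" "l \<in> carrier N" "k' \<in> carrier N" "l' \<in> carrier N"
      using kl KsE(1) LE(1) by auto
    then have "a \<oplus>\<^bsub>N\<^esub> b = (k \<oplus>\<^bsub>N\<^esub> k') \<oplus>\<^bsub>N\<^esub> (l \<oplus>\<^bsub>N\<^esub> l')"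
      using kl by (simp add: N.a_ac)
    moreover have "k \<oplus>\<^bsub>N\<^esub> k' \<in> g ` K" "l \<oplus>\<^bsub>N\<^esub> l' \<in> L" using kl KsE(5) LE(5) by auto
    ultimately show "a \<oplus>\<^bsub>N\<^esub> b \<in> K'" by (simp add: K'I)
  next
    fix a x assume a: "a \<in> carrier R" and "x \<in> K'"
    then obtain k l where kl: "k \<in> g ` K" "l \<in> L" "x = k \<oplus>\<^bsub>N\<^esub> l" by (auto simp: K'_iff)
    have "k \<in> carrier N" "l \<in> carrier N" using kl KsE(1) LE(1) by auto
    then have "a \<odot>\<^bsub>N\<^esub> x = a \<odot>\<^bsub>N\<^esub> k \<oplus>\<^bsub>N\<^esub> a \<odot>\<^bsub>N\<^esub> l" using a kl(3) by (simp add: N.smult_r_distr)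
    moreover have "a \<odot>\<^bsub>N\<^esub> k \<in> g ` K" "a \<odot>\<^bsub>N\<^esub> l \<in> L" using a kl KsE(4) LE(4) by auto
    ultimately show "a \<odot>\<^bsub>N\<^esub> x \<in> K'" by (simp add: K'I)
  qed
  have disj: "x = \<zero>\<^bsub>N\<^esub>" if x: "x \<in> g ` H" "x \<in> K'" for x
  proof -
    obtain h where h: "h \<in> H" "x = g h" using x by auto
    obtain k l where kl: "k \<in> K" "l \<in> L" "x = g k \<oplus>\<^bsub>N\<^esub> l" using x by (auto simp: K'_iff)
    have hc: "h \<in> carrier M" "k \<in> carrier M" "l \<in> carrier N" using h kl HE(1) KE(1) LE(1) by auto
    have mk: "\<ominus>\<^bsub>M\<^esub> k \<in> carrier M" using hc by simp
    have "g (\<ominus>\<^bsub>M\<^esub> k) \<oplus>\<^bsub>N\<^esub> g k = \<zero>\<^bsub>N\<^esub>"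
      using hc mk gD(3)[of "\<ominus>\<^bsub>M\<^esub> k" k] by (simp add: M.l_neg g0)
    moreover have "g (h \<oplus>\<^bsub>M\<^esub> \<ominus>\<^bsub>M\<^esub> k) = g (\<ominus>\<^bsub>M\<^esub> k) \<oplus>\<^bsub>N\<^esub> g h"
      using hc mk gD(3)[of h "\<ominus>\<^bsub>M\<^esub> k"] gD(2) by (simp add: N.a_comm)
    moreover have "g h = g k \<oplus>\<^bsub>N\<^esub> l" using h kl by simp
    ultimately have "g (h \<oplus>\<^bsub>M\<^esub> \<ominus>\<^bsub>M\<^esub> k) = l"
      using hc mk gD(2) N.a_assoc[of "g (\<ominus>\<^bsub>M\<^esub> k)" "g k" l] by simp
    moreover have "h \<oplus>\<^bsub>M\<^esub> \<ominus>\<^bsub>M\<^esub> k \<in> carrier M" using hc mk by simp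
    ultimately have "l \<in> g ` carrier M \<inter> L" using kl(2) by blast
    then have "l = \<zero>\<^bsub>N\<^esub>" using L(2) by auto
    then have "g h = g k" using h kl hc gD(2) by simp
    then have "h = k" using inj hc by (auto dest: inj_onD)
    then have "h = \<zero>\<^bsub>M\<^esub>" using h kl K(2) by auto
    then show ?thesis using h g0 by simp
  qed
  have "\<zero>\<^bsub>N\<^esub> \<in> g ` H" using zK(2) g0 by (metis image_eqI)
  moreover have "\<zero>\<^bsub>N\<^esub> \<in> K'" using subgroup.one_closed[of K' "add_monoid N"] K'sub
    by (simp add: submodule_def)
  ultimately have inter: "g ` H \<inter> K' = {\<zero>\<^bsub>N\<^esub>}" using disj by blast
  have Hsub: "submodule (g ` H) R N" by (rule submodule_image[OF MN lin Hs])
  have "carrier N \<subseteq> g ` H <+>\<^bsub>N\<^esub> K'"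
  proof
    fix v assume "v \<in> carrier N"
    then have "v \<in> g ` carrier M <+>\<^bsub>N\<^esub> L" using L(3) by simp
    then obtain m l where ml: "m \<in> carrier M" "l \<in> L" "v = g m \<oplus>\<^bsub>N\<^esub> l"
      by (auto simp: set_add_def')
    have "m \<in> H <+>\<^bsub>M\<^esub> K" using ml K(3) by simp
    then obtain h k where hk: "h \<in> H" "k \<in> K" "m = h \<oplus>\<^bsub>M\<^esub> k"
      by (auto simp: set_add_def')
    have c: "h \<in> carrier M" "k \<in> carrier M" "l \<in> carrier N" using hk ml HE(1) KE(1) LE(1) by auto
    have "v = g h \<oplus>\<^bsub>N\<^esub> (g k \<oplus>\<^bsub>N\<^esub> l)"
      using ml hk c gD(2,3) by (simp add: N.a_assoc)
    moreover have "g k \<oplus>\<^bsub>N\<^esub> l \<in> K'" using hk ml by (auto simp: K'_iff)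
    ultimately show "v \<in> g ` H <+>\<^bsub>N\<^esub> K'" using hk(1)
      unfolding set_add_def' by blast
  qed
  moreover have "g ` H <+>\<^bsub>N\<^esub> K' \<subseteq> carrier N"
    using N.submoduleE(1)[OF Hsub] N.submoduleE(1)[OF K'sub] by (auto simp: set_add_def')
  ultimately show ?thesis
    unfolding direct_summand_def using Hsub K'sub inter by blast
qed

lemma splittable_injections_compose:
  assumes "module R L" "module R M" "module R N"
    and "f \<in> splittable_maps R L M"
    and "g \<in> splittable_maps R M N" "inj_on g (carrier M)"
  shows "compose (carrier L) g f \<in> splittable_maps R L N"
proof -
  have "compose (carrier L) g f ` carrier L = g ` (f ` carrier L)"
    by (auto simp: compose_def image_iff)
  then show ?thesis
    using assms direct_summand_image[OF assms(2,3,5,6)] linear_maps_compose[OF assms(1)]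
    by (auto simp: splittable_maps_def)
qed

lemma compose_laws:
  assumes "f \<in> linear_maps R K L"
  shows "compose (carrier K) f (restrict id (carrier K)) = f"
    and "compose (carrier K) (restrict id (carrier L)) f = f"
    and "compose (carrier K) h (compose (carrier K) g f)
      = compose (carrier K) (compose (carrier L) h g) f"
  using linear_mapsD(1,2)[OF assms]
  by (auto simp: compose_def fun_eq_iff extensional_def PiE_def)

lemma category_linear_iff:
  assumes Ob: "\<And>M. M \<in> Ob C \<Longrightarrow> module R M"
    and Mor: "\<And>M N. Mor C M N \<subseteq> linear_maps R M N"
    and Cmp: "Cmp C = (\<lambda>L M N g f. compose (carrier L) g f)"
    and Idm: "Idm C = (\<lambda>M. restrict id (carrier M))"
    and Idm_in: "\<And>M. M \<in> Ob C \<Longrightarrow> restrict id (carrier M) \<in> Mor C M M"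
  shows "category C \<longleftrightarrow> (\<forall>L \<in> Ob C. \<forall>M \<in> Ob C. \<forall>N \<in> Ob C.
           \<forall>f \<in> Mor C L M. \<forall>g \<in> Mor C M N. compose (carrier L) g f \<in> Mor C L N)"
    (is "_ \<longleftrightarrow> ?closed")
proof
  assume "category C"
  then show ?closed
    using category.Cmp_in[of C] unfolding Cmp by blast
next
  assume cl: ?closed
  show "category C"
  proof
    show "Idm C x \<in> Mor C x x" if "x \<in> Ob C" for x
      using Idm_in[OF that] by (simp add: Idm)
    show "Cmp C x y z g f \<in> Mor C x z"
      if "x \<in> Ob C" "y \<in> Ob C" "z \<in> Ob C" "f \<in> Mor C x y" "g \<in> Mor C y z" for x y z f g
      using cl that by (simp add: Cmp)
    show "Cmp C x x y f (Idm C x) = f" if "f \<in> Mor C x y" for x y f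
      using compose_laws(1)[of f R x y] that Mor by (auto simp: Cmp Idm)
    show "Cmp C x y y (Idm C y) f = f" if "f \<in> Mor C x y" for x y f
      using compose_laws(2)[of f R x y] that Mor by (auto simp: Cmp Idm)
    show "Cmp C w y z h (Cmp C w x y g f) = Cmp C w x z (Cmp C x y z h g) f"
      if "f \<in> Mor C w x" "g \<in> Mor C x y" for w x y z f g h
      using compose_laws(3)[of f R w x h g] that Mor by (auto simp: Cmp)
  qed
qed

lemma category_VI: "category (VI R :: (('a, 'b) module, 'b \<Rightarrow> 'b) cat)"
proof (subst category_linear_iff[where R = R])
  show "\<forall>L \<in> Ob (VI R). \<forall>M \<in> Ob (VI R). \<forall>N \<in> Ob (VI R).
      \<forall>f \<in> Mor (VI R) L M. \<forall>g \<in> Mor (VI R) M N.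
        compose (carrier L) g f \<in> Mor (VI R :: (('a, 'b) module, 'b \<Rightarrow> 'b) cat) L N"
  proof (intro ballI)
    fix L M N :: "('a, 'b) module" and f g
    assume a: "L \<in> Ob (VI R)" "M \<in> Ob (VI R)" "N \<in> Ob (VI R)"
      "f \<in> Mor (VI R) L M" "g \<in> Mor (VI R) M N"
    have f: "f \<in> splittable_maps R L M" "inj_on f (carrier L)"
      and g: "g \<in> splittable_maps R M N" "inj_on g (carrier M)"
      and m: "module R L" "module R M" "module R N"
      using a by (simp_all add: VI_def free_finite_rank_def)
    have "f ` carrier L \<subseteq> carrier M"
      using f(1) linear_mapsD(2)[of f R L M] by (auto simp: splittable_maps_def)
    then have "inj_on (g \<circ> f) (carrier L)"
      using f(2) g(2) by (metis comp_inj_on inj_on_subset)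
    moreover have "inj_on (compose (carrier L) g f) (carrier L) \<longleftrightarrow> inj_on (g \<circ> f) (carrier L)"
      by (rule inj_on_cong) (simp add: compose_def)
    ultimately show "compose (carrier L) g f \<in> Mor (VI R) L N"
      using splittable_injections_compose[OF m f(1) g] by (simp add: VI_def)
  qed
qed (auto simp: VI_def free_finite_rank_def restrict_id_splittable splittable_maps_def[of R]
       inj_on_def dest: restrict_id_splittable)

lemma category_VA_iff:
  "category (VA R :: (('a, 'b) module, 'b \<Rightarrow> 'b) cat) \<longleftrightarrow>
   (\<forall>(L :: ('a, 'b) module) (M :: ('a, 'b) module) (N :: ('a, 'b) module).
      free_finite_rank R L \<longrightarrow> free_finite_rank R M \<longrightarrow> free_finite_rank R N \<longrightarrow>
      (\<forall>f \<in> splittable_maps R L M. \<forall>g \<in> splittable_maps R M N.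
         compose (carrier L) g f \<in> splittable_maps R L N))"
proof (subst category_linear_iff[where R = R])
  show "Mor (VA R) M N \<subseteq> linear_maps R M N" for M N :: "('a, 'b) module"
    by (auto simp: VA_def splittable_maps_def)
qed (auto simp: VA_def free_finite_rank_def intro: restrict_id_splittable)

end

theory Submission
  imports Defs "HOL-Library.Sublist" "HOL-Library.Nat_Bijection" "HOL-Library.Infinite_Set"
begin

text \<open>
  The Groebner category is the opposite of the category of ordered surjections between finite
  ordinals. Its morphisms out of \<open>n\<close> are words over \<open>n\<close> letters, well-ordered lexicographically;
  one word lies below another if it embeds as a subword hitting all first occurrences of letters, so
  noetherianity follows from Higman's lemma. A surjection from \<open>m\<close> to \<open>n\<close> induces by pullback of
  functions a split injection $R^n \to R^m$. A linear map $U \to R^m$ is a word of length \<open>m\<close> in the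
  finite set of linear forms on \<open>U\<close>, and recording only its distinct letters in order of appearance
  factors it through one of finitely many maps $U \to R^k$, which is splittable (injective) if the
  given map is. Hence the functor has property (F) for both categories.
\<close>

section \<open>Higman's lemma for finite alphabets\<close>

text \<open>Postcomposition with an automorphism acts on a well-ordered hom-set as an order
  automorphism, hence trivially, so a Groebner category has no automorphisms but identities.
  \<open>VI\<close> and \<open>VA\<close> therefore need a rigid replacement, and the condition on
  first occurrences is what removes the permutations from the surjections. The count behind property
  (F): a letter is a function from the finite module \<open>U\<close> to the finite ring, so at most
  |R|^|U| distinct letters occur, whatever the target. Failure of composition in \<open>VA\<close>
  does no harm: a splittable map is only ever composed with an injection coming from the functor or
  with an isomorphism. Words are coded by natural numbers so that objects and morphisms of the
  auxiliary category both live on \<open>nat\<close>. Its objects are limited to a set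
  \<open>A\<close> of ranks, since a finite element type may realize only some; \<open>A\<close> has
  to be closed downwards for the middle term of a factorization to exist.\<close>

definition bad_seq :: "'a set \<Rightarrow> (nat \<Rightarrow> 'a list) \<Rightarrow> bool" where
  "bad_seq A s \<longleftrightarrow> range s \<subseteq> lists A \<and> (\<forall>i j. i < j \<longrightarrow> \<not> subseq (s i) (s j))"

text \<open>Nash-Williams: in a minimal bad sequence, deleting a common first letter from infinitely many
  terms produces a smaller bad sequence.\<close>

theorem higman:
  fixes s :: "nat \<Rightarrow> 'a list"
  assumes A: "finite A" and s: "range s \<subseteq> lists A"
  shows "\<exists>i j. i < j \<and> subseq (s i) (s j)"
proof (rule ccontr)
  assume "\<not> ?thesis"
  then have bad: "bad_seq A s" using s by (auto simp: bad_seq_def)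
  \<comment> \<open>Stage \<open>n\<close> replaces the current bad sequence by one that agrees with
    it below \<open>n\<close> and has the shortest possible entry at \<open>n\<close>.
    \<open>?P\<close> carries a dummy index because dependent choice expects one.\<close>
  let ?P = "\<lambda>n t. bad_seq A t"
  let ?Q = "\<lambda>n t t'. (\<forall>i<n. t' i = t i) \<and>
      (\<forall>u. bad_seq A u \<and> (\<forall>i<n. u i = t i) \<longrightarrow> length (t' n) \<le> length (u n))"
  have "\<exists>S. \<forall>n. ?P n (S n) \<and> ?Q n (S n) (S (Suc n))"
  proof (rule dependent_nat_choice)
    show "\<exists>t. bad_seq A t" using bad by blast
    fix t and n :: nat assume "bad_seq A t"
    then have "bad_seq A t \<and> (\<forall>i<n. t i = t i)" by simp
    then obtain t' where t': "bad_seq A t' \<and> (\<forall>i<n. t' i = t i)"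
      "\<forall>u. bad_seq A u \<and> (\<forall>i<n. u i = t i) \<longrightarrow> length (t' n) \<le> length (u n)"
      using ex_has_least_nat[where P = "\<lambda>u. bad_seq A u \<and> (\<forall>i<n. u i = t i)"
        and m = "\<lambda>u. length (u n)"] by blast
    then show "\<exists>t'. bad_seq A t' \<and> ?Q n t t'" by (intro exI[of _ t'] conjI) simp_all
  qed
  then obtain S where S0: "\<forall>n. ?P n (S n) \<and> ?Q n (S n) (S (Suc n))" by (rule exE)
  have S: "bad_seq A (S n)" "i < n \<Longrightarrow> S (Suc n) i = S n i" for n i
    using spec[OF S0, of n] by simp_all
  have S_min: "length (S (Suc n) n) \<le> length (u n)" if "bad_seq A u" "\<forall>i<n. u i = S n i" for n u
    using spec[OF S0, of n] that by simp
  \<comment> \<open>Entry \<open>n\<close> is frozen from stage \<open>Suc n\<close> on, so every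
    initial segment of the diagonal \<open>m\<close> is an initial segment of a single bad
    sequence.\<close>
  define m where "m n = S (Suc n) n" for n
  have stable: "S k i = m i" if "i < k" for i k
    using that
  proof (induction k)
    case (Suc k) then show ?case using S(2)[of i k] by (cases "i = k") (auto simp: m_def)
  qed simp
  have m_not: "\<not> subseq (m i) (m j)" if "i < j" for i j
  proof -
    have "\<not> subseq (S (Suc j) i) (S (Suc j) j)"
      using S(1)[of "Suc j"] that unfolding bad_seq_def by blast
    then show ?thesis using that by (simp add: stable)
  qed
  have m_lists: "m i \<in> lists A" for i
    using S(1)[of "Suc i"] by (simp add: m_def bad_seq_def image_subset_iff del: in_lists_conv_set)
  have minimal: "length (m n) \<le> length (u n)" if "bad_seq A u" "\<And>i. i < n \<Longrightarrow> u i = m i" for u n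
    using S_min[of u n] that by (simp add: stable)
  have nonempty: "m i \<noteq> []" for i
    using m_not[of i "Suc i"] by auto
  have "hd (m i) \<in> A" for i
    using m_lists[of i] nonempty[of i] by (cases "m i") auto
  then have "finite (range (\<lambda>i. hd (m i)))"
    by (intro finite_subset[OF _ A] image_subsetI)
  from pigeonhole_infinite[OF infinite_UNIV_nat this]
  obtain k where "infinite {i. hd (m i) = hd (m k)}" by auto
  from infinite_enumerate[OF this] obtain e :: "nat \<Rightarrow> nat"
    where e: "strict_mono e" "\<And>i. hd (m (e i)) = hd (m k)" by auto
  \<comment> \<open>The tails start exactly at position \<open>e 0\<close>, the first chosen index,
    so \<open>t\<close> agrees with \<open>m\<close> before \<open>e 0\<close> and has a shorter
    entry there; minimality is violated at this index.\<close>
  define t where "t i = (if i < e 0 then m i else tl (m (e (i - e 0))))" for i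
  have split: "m (e i) = hd (m k) # tl (m (e i))" for i
    using nonempty[of "e i"] e(2)[of i] by (simp flip: e(2)[of i])
  have e_ge: "e 0 \<le> e i" for i
    using e(1) by (simp add: strict_mono_less_eq)
  have "bad_seq A t"
    unfolding bad_seq_def
  proof (intro conjI allI impI)
    have "tl (m i) \<in> lists A" for i
      using m_lists[of i] nonempty[of i] by (cases "m i") auto
    then show "range t \<subseteq> lists A"
      using m_lists by (auto simp: t_def)
    fix i j :: nat assume ij: "i < j"
    consider "j < e 0" | "i < e 0" "e 0 \<le> j" | "e 0 \<le> i" by linarith
    then show "\<not> subseq (t i) (t j)"
    proof cases
      case 1 then show ?thesis using ij m_not by (simp add: t_def)
    next
      case 2
      then have "\<not> subseq (m i) (m (e (j - e 0)))"
        using e_ge[of "j - e 0"] by (intro m_not) simp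
      then have "\<not> subseq (m i) (tl (m (e (j - e 0))))"
        by (subst (asm) split) auto
      then show ?thesis using 2 by (simp add: t_def)
    next
      case 3
      then have "e (i - e 0) < e (j - e 0)"
        using ij e(1) by (simp add: strict_mono_less)
      then have "\<not> subseq (m (e (i - e 0))) (m (e (j - e 0)))" by (rule m_not)
      then have "\<not> subseq (tl (m (e (i - e 0)))) (tl (m (e (j - e 0))))"
        using split[of "i - e 0"] split[of "j - e 0"] by (metis subseq_Cons2)
      then show ?thesis using 3 ij by (simp add: t_def)
    qed
  qed
  then have "length (m (e 0)) \<le> length (t (e 0))"
    by (rule minimal) (simp add: t_def)
  then show False using nonempty[of "e 0"] by (cases "m (e 0)") (auto simp: t_def)
qed

text \<open>Marks are compared position by position, so the inductive subword relation has to be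
  turned into a position map: a skipped letter shifts the map by one, a matched letter sends 0 to 0
  and shifts the rest.\<close>

lemma subseq_embedding:
  assumes "subseq xs ys"
  shows "\<exists>\<iota>. strict_mono_on {..<length xs} \<iota> \<and>
    (\<forall>i<length xs. \<iota> i < length ys \<and> ys ! \<iota> i = xs ! i)"
  using assms
proof (induction rule: list_emb.induct)
  case (list_emb_Nil ys)
  show ?case by (auto simp: strict_mono_on_def)
next
  case (list_emb_Cons xs ys y)
  then obtain \<iota> where "strict_mono_on {..<length xs} \<iota>"
    "\<forall>i<length xs. \<iota> i < length ys \<and> ys ! \<iota> i = xs ! i" by blast
  then show ?case by (intro exI[of _ "Suc \<circ> \<iota>"]) (auto simp: strict_mono_on_def)
next
  case (list_emb_Cons2 x y xs ys)
  then obtain \<iota> where "strict_mono_on {..<length xs} \<iota>"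
    "\<forall>i<length xs. \<iota> i < length ys \<and> ys ! \<iota> i = xs ! i" by blast
  then show ?case using list_emb_Cons2.hyps(1)
    by (intro exI[of _ "\<lambda>i. case i of 0 \<Rightarrow> 0 | Suc j \<Rightarrow> Suc (\<iota> j)"])
       (auto simp: strict_mono_on_def split: nat.splits)
qed

section \<open>Ordered surjections\<close>

text \<open>A surjection \<open>w\<close> from \<open>{..<m}\<close> to \<open>{..<n}\<close>, written as a word of length \<open>m\<close>, is ordered if
  the letters occur for the first time in increasing order.\<close>

definition ordered_surj :: "nat \<Rightarrow> nat \<Rightarrow> nat list set" where
  "ordered_surj n m =
     {w. length w = m \<and> set w = {..<n} \<and> (\<forall>i<m. \<forall>a<w ! i. \<exists>j<i. w ! j = a)}"

lemma ordered_surjD: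
  assumes "w \<in> ordered_surj n m"
  shows "length w = m" and "set w = {..<n}" and "\<And>i. i < m \<Longrightarrow> w ! i < n"
    and "\<And>i a. i < m \<Longrightarrow> a < w ! i \<Longrightarrow> \<exists>j<i. w ! j = a"
    and "\<And>a. a < n \<Longrightarrow> \<exists>i<m. w ! i = a"
proof -
  show *: "length w = m" "set w = {..<n}"
    and "\<And>i a. i < m \<Longrightarrow> a < w ! i \<Longrightarrow> \<exists>j<i. w ! j = a"
    using assms by (auto simp: ordered_surj_def)
  show "w ! i < n" if "i < m" for i
    using nth_mem[of i w] that by (simp add: *)
  show "\<exists>i<m. w ! i = a" if "a < n" for a
    using in_set_conv_nth[of a w] that by (auto simp: *)
qed

lemma ordered_surjI:
  assumes "length w = m" "\<And>i. i < m \<Longrightarrow> w ! i < n" "\<And>a. a < n \<Longrightarrow> \<exists>i<m. w ! i = a"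
    and "\<And>i a. i < m \<Longrightarrow> a < w ! i \<Longrightarrow> \<exists>j<i. w ! j = a"
  shows "w \<in> ordered_surj n m"
  using assms unfolding ordered_surj_def by (auto simp: set_conv_nth)

lemma finite_ordered_surj: "finite (ordered_surj n m)"
  by (rule finite_subset[OF _ finite_lists_length_eq[of "{..<n}" m]]) (auto simp: ordered_surj_def)

lemma ordered_surj_le:
  assumes "w \<in> ordered_surj n m" shows "n \<le> m"
proof -
  have "card (set w) \<le> length w" by (rule card_length)
  then show ?thesis using ordered_surjD(1,2)[OF assms] by simp
qed

lemma ordered_surj_id: "[0..<n] \<in> ordered_surj n n"
  by (rule ordered_surjI) auto

text \<open>Orderedness passes through in two steps: \<open>f\<close> takes the value
  \<open>a\<close> at some \<open>p\<close> below \<open>h ! i\<close>, and \<open>h\<close> in turn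
  takes the value \<open>p\<close> before \<open>i\<close>.\<close>

lemma ordered_surj_compose:
  assumes f: "f \<in> ordered_surj n m" and h: "h \<in> ordered_surj m k"
  shows "map ((!) f) h \<in> ordered_surj n k"
proof (rule ordered_surjI)
  note f = ordered_surjD[OF f] and h = ordered_surjD[OF h]
  show len: "length (map ((!) f) h) = k" by (simp add: h)
  show "map ((!) f) h ! i < n" if "i < k" for i using that by (simp add: f h)
  show "\<exists>i<k. map ((!) f) h ! i = a" if "a < n" for a
    using f(5)[OF that] h(5) h(1) by (metis nth_map)
  show "\<exists>j<i. map ((!) f) h ! j = a" if i: "i < k" and a: "a < map ((!) f) h ! i" for i a
  proof -
    have "a < f ! (h ! i)" using i a by (simp add: h)
    then obtain p where p: "p < h ! i" "f ! p = a" using f(4)[OF h(3)[OF i]] by blast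
    obtain j where "j < i" "h ! j = p" using h(4)[OF i p(1)] by blast
    then show ?thesis using p i by (intro exI[of _ j]) (simp add: h)
  qed
qed

lemma ordered_surj_snoc:
  assumes h: "h \<in> ordered_surj n m" and a: "a \<le> n"
  shows "h @ [a] \<in> ordered_surj (max n (Suc a)) (Suc m)"
proof -
  note hD = ordered_surjD[OF h]
  have old: "(h @ [a]) ! i = h ! i" if "i < m" for i
    using that hD(1) by (simp add: nth_append)
  have new: "(h @ [a]) ! m = a"
    using hD(1) by (simp add: nth_append)
  show ?thesis
  proof (rule ordered_surjI)
    show "length (h @ [a]) = Suc m" using hD(1) by simp
    show "(h @ [a]) ! i < max n (Suc a)" if "i < Suc m" for i
      using that hD(3)[of i] old[of i] new by (cases "i = m") auto
    show "\<exists>i<Suc m. (h @ [a]) ! i = b" if b: "b < max n (Suc a)" for b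
    proof (cases "b < n")
      case True
      then obtain i where "i < m" "h ! i = b" using hD(5) by blast
      then show ?thesis using old[of i] less_SucI by blast
    next
      case False
      then have "b = a" using b a by simp
      then show ?thesis using new by blast
    qed
    show "\<exists>j<i. (h @ [a]) ! j = b" if i: "i < Suc m" and b: "b < (h @ [a]) ! i" for i b
    proof (cases "i = m")
      case True
      then obtain j where "j < m" "h ! j = b" using b new a hD(5)[of b] by auto
      then show ?thesis using old[of j] True by blast
    next
      case False
      then have im: "i < m" using i by simp
      then obtain j where "j < i" "h ! j = b" using b old hD(4)[of i b] by auto
      then show ?thesis using old[of j] im by (meson order.strict_trans)
    qed
  qed
qed

text \<open>Reading \<open>\<rho>\<close> from left to right, a value met before receives its old
  number and a new value the next number \<open>n\<close>. Injectivity of \<open>r\<close> later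
  bounds \<open>n\<close> by the number of possible values.\<close>

lemma ordered_surj_factorization:
  fixes \<rho> :: "nat \<Rightarrow> 'c"
  shows "\<exists>n. \<exists>h \<in> ordered_surj n m. \<exists>r. inj_on r {..<n} \<and> (\<forall>i<m. \<rho> i = r (h ! i))"
proof (induction m)
  case 0
  have "[] \<in> ordered_surj 0 0" by (rule ordered_surjI) auto
  then show ?case by (intro exI[of _ 0]) auto
next
  case (Suc m)
  then obtain n h r where h: "h \<in> ordered_surj n m" and r: "inj_on r {..<n}"
    and \<rho>: "\<forall>i<m. \<rho> i = r (h ! i)" by blast
  note hD = ordered_surjD[OF h]
  show ?case
  proof (cases "\<rho> m \<in> r ` {..<n}")
    case True
    then obtain a where a: "a < n" "\<rho> m = r a" by auto
    then have "h @ [a] \<in> ordered_surj n (Suc m)"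
      using ordered_surj_snoc[OF h, of a] by (simp add: max_absorb1)
    moreover have "\<forall>i<Suc m. \<rho> i = r ((h @ [a]) ! i)"
      using \<rho> a hD(1) by (simp add: nth_append less_Suc_eq)
    ultimately show ?thesis using r by blast
  next
    case False
    let ?r = "r(n := \<rho> m)"
    have "h @ [n] \<in> ordered_surj (Suc n) (Suc m)"
      using ordered_surj_snoc[OF h, of n] by simp
    moreover have "\<forall>i<Suc m. \<rho> i = ?r ((h @ [n]) ! i)"
      using \<rho> hD(1) less_imp_neq[OF hD(3)] by (simp add: nth_append less_Suc_eq)
    moreover have "inj_on ?r {..<Suc n}"
      using r False by (simp add: lessThan_Suc inj_on_fun_updI inj_on_insert image_iff)
    ultimately show ?thesis by blast
  qed
qed

text \<open>Marking each letter by whether it has occurred before makes Higman's embeddings preserve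
  first occurrences.\<close>

definition mark :: "nat list \<Rightarrow> (nat \<times> bool) list" where
  "mark w = map (\<lambda>i. (w ! i, w ! i \<in> set (take i w))) [0..<length w]"

lemma length_mark [simp]: "length (mark w) = length w"
  by (simp add: mark_def)

lemma nth_mark: "i < length w \<Longrightarrow> mark w ! i = (w ! i, w ! i \<in> set (take i w))"
  by (simp add: mark_def)

lemma ex_first_occurrence:
  assumes "a \<in> set w"
  shows "\<exists>i<length w. w ! i = a \<and> a \<notin> set (take i w)"
proof -
  obtain xs ys where "w = xs @ a # ys" "a \<notin> set xs"
    using split_list_first[OF assms] by blast
  then show ?thesis by (intro exI[of _ "length xs"]) auto
qed

text \<open>The map \<open>h\<close> sends \<open>\<iota> i\<close> back to \<open>i\<close> and any
  other position \<open>p\<close> to the first occurrence in \<open>f\<close> of the letter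
  \<open>g ! p\<close>. This yields \<open>\<iota> (h p) \<le> p\<close> in all cases, the
  inequality that makes \<open>h\<close> ordered.\<close>

lemma subseq_mark_factorization:
  assumes f: "f \<in> ordered_surj n m" and g: "g \<in> ordered_surj n k"
    and sub: "subseq (mark f) (mark g)"
  shows "\<exists>h \<in> ordered_surj m k. g = map ((!) f) h"
proof -
  note fD = ordered_surjD[OF f] and gD = ordered_surjD[OF g]
  obtain \<iota> where \<iota>: "strict_mono_on {..<m} \<iota>" "\<And>i. i < m \<Longrightarrow> \<iota> i < k"
    "\<And>i. i < m \<Longrightarrow> mark g ! \<iota> i = mark f ! i"
    using subseq_embedding[OF sub] by (auto simp: fD(1) gD(1))
  have letter: "g ! \<iota> i = f ! i"
    and first: "f ! i \<notin> set (take i f) \<Longrightarrow> f ! i \<notin> set (take (\<iota> i) g)" if "i < m" for i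
    using \<iota>(2,3)[OF that] that by (auto simp: nth_mark fD(1) gD(1))
  have mono: "\<iota> a < \<iota> b" if "a < b" "b < m" for a b
    using strict_mono_onD[OF \<iota>(1)] that by auto
  have inj: "inj_on \<iota> {..<m}"
    using \<iota>(1) by (rule strict_mono_on_imp_inj_on)
  have "\<exists>i<m. f ! i = g ! p \<and> \<iota> i \<le> p \<and> (p \<in> \<iota> ` {..<m} \<longrightarrow> \<iota> i = p)" if p: "p < k" for p
  proof (cases "p \<in> \<iota> ` {..<m}")
    case True then show ?thesis using letter by auto
  next
    case False
    have "g ! p \<in> set f" using gD(3)[OF p] fD(2) by simp
    then obtain i where i: "i < m" "f ! i = g ! p" "f ! i \<notin> set (take i f)"
      using ex_first_occurrence fD(1) by metis
    \<comment> \<open>The mark makes \<open>\<iota> i\<close> the first occurrence in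
      \<open>g\<close> of its letter, so the occurrence at \<open>p\<close> cannot come
      earlier.\<close>
    have "\<iota> i \<le> p"
    proof (rule ccontr)
      assume "\<not> \<iota> i \<le> p"
      then have "g ! p \<in> set (take (\<iota> i) g)"
        using \<iota>(2)[OF i(1)] p gD(1) by (auto simp: in_set_conv_nth intro!: exI[of _ p])
      then show False using first[OF i(1,3)] i(2) by simp
    qed
    then show ?thesis using i False by blast
  qed
  then obtain h where h: "\<forall>p<k. h p < m \<and> f ! h p = g ! p \<and> \<iota> (h p) \<le> p \<and>
      (p \<in> \<iota> ` {..<m} \<longrightarrow> \<iota> (h p) = p)"
    by metis
  have h\<iota>: "h (\<iota> i) = i" if "i < m" for i
    using inj_onD[OF inj, of "h (\<iota> i)" i] h \<iota>(2)[OF that] that by auto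
  have "map h [0..<k] \<in> ordered_surj m k"
  proof (rule ordered_surjI)
    show "\<exists>p<k. map h [0..<k] ! p = a" if "a < m" for a
      using h\<iota>[OF that] \<iota>(2)[OF that] by auto
    show "\<exists>q<p. map h [0..<k] ! q = a" if "p < k" "a < map h [0..<k] ! p" for p a
    proof -
      have "a < h p" using that by simp
      \<comment> \<open>The value \<open>a\<close> is taken by \<open>h\<close> at position
        \<open>\<iota> a\<close>, which precedes \<open>\<iota> (h p)\<close> and hence
        \<open>p\<close>.\<close>
      then have "\<iota> a < \<iota> (h p)" "a < m" using mono h that(1) by auto
      then have "\<iota> a < p" "h (\<iota> a) = a" using h h\<iota> that(1) order.strict_trans2 by blast+
      then show ?thesis using that by auto
    qed
  qed (use h in auto)
  moreover have "g = map ((!) f) (map h [0..<k])"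
    by (rule nth_equalityI) (auto simp: gD(1) h)
  ultimately show ?thesis by blast
qed

text \<open>The opposite of the category of ordered surjections, restricted to the finite sets
  \<open>{..<n}\<close> with \<open>n \<in> A\<close>: a morphism from \<open>n\<close> to \<open>m\<close> is the code of an ordered surjection from
  \<open>{..<m}\<close> to \<open>{..<n}\<close>.\<close>

definition OS_op :: "nat set \<Rightarrow> (nat, nat) cat" where
  "OS_op A = \<lparr>Ob = A,
     Mor = (\<lambda>n m. list_encode ` ordered_surj n m),
     Cmp = (\<lambda>_ _ _ h f. list_encode (map ((!) (list_decode f)) (list_decode h))),
     Idm = (\<lambda>n. list_encode [0..<n])\<rparr>"

lemma OS_op_simps [simp]:
  "Ob (OS_op A) = A"
  "Mor (OS_op A) n m = list_encode ` ordered_surj n m"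
  "Cmp (OS_op A) n m k (list_encode h) (list_encode f) = list_encode (map ((!) f) h)"
  "Idm (OS_op A) n = list_encode [0..<n]"
  by (simp_all add: OS_op_def)

lemma category_OS_op: "category (OS_op A)"
proof
  fix w x y z f g h
  show "Idm (OS_op A) x \<in> Mor (OS_op A) x x" by (simp add: ordered_surj_id)
  show "Cmp (OS_op A) x y z g f \<in> Mor (OS_op A) x z"
    if "f \<in> Mor (OS_op A) x y" "g \<in> Mor (OS_op A) y z"
    using that ordered_surj_compose by auto
  show "Cmp (OS_op A) x x y f (Idm (OS_op A) x) = f" if f: "f \<in> Mor (OS_op A) x y"
  proof -
    obtain w where w: "w \<in> ordered_surj x y" "f = list_encode w" using f by auto
    then have "map ((!) [0..<x]) w = w" by (intro map_idI) (auto simp: ordered_surj_def)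
    then show ?thesis by (simp add: w(2) list_encode_eq)
  qed
  show "Cmp (OS_op A) x y y (Idm (OS_op A) y) f = f" if "f \<in> Mor (OS_op A) x y"
    using that by (auto simp: ordered_surj_def intro!: arg_cong[of _ _ list_encode] nth_equalityI)
  show "Cmp (OS_op A) w y z h (Cmp (OS_op A) w x y g f) =
      Cmp (OS_op A) w x z (Cmp (OS_op A) x y z h g) f"
    if "f \<in> Mor (OS_op A) w x" "g \<in> Mor (OS_op A) x y" "h \<in> Mor (OS_op A) y z"
    using that by (auto simp: ordered_surj_def list_encode_eq)
qed

section \<open>Lexicographic well-orders and noetherianity\<close>

definition lex_le :: "nat list \<Rightarrow> nat list \<Rightarrow> bool" where
  "lex_le f g \<longleftrightarrow> f = g \<or>
     (\<exists>i<length g. length f = length g \<and> f ! i < g ! i \<and> (\<forall>j<i. f ! j = g ! j))"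

text \<open>Words of different lengths are incomparable unless equal; all words of one hom-set have
  the same length, so the order is total where it is used.\<close>

lemma lex_le_linear:
  assumes "length f = length g"
  shows "lex_le f g \<or> lex_le g f"
proof (cases "f = g")
  case False
  define i where "i = (LEAST i. f ! i \<noteq> g ! i)"
  obtain k where k: "k < length g" "f ! k \<noteq> g ! k" using False assms by (metis nth_equalityI)
  have "f ! i \<noteq> g ! i" unfolding i_def using k(2) by (rule LeastI)
  then consider "f ! i < g ! i" | "g ! i < f ! i" by linarith
  moreover have "i < length g" unfolding i_def using k by (meson Least_le order.strict_trans1)
  moreover have "f ! j = g ! j" if "j < i" for j using not_less_Least that unfolding i_def by blast
  ultimately show ?thesis using assms unfolding lex_le_def by cases auto
qed (simp add: lex_le_def)

lemma lex_le_antisym: "lex_le f g \<Longrightarrow> lex_le g f \<Longrightarrow> f = g"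
  unfolding lex_le_def by (metis less_asym linorder_neqE_nat less_irrefl)

lemma lex_le_trans:
  assumes "lex_le f g" "lex_le g h" shows "lex_le f h"
proof (cases "f = g \<or> g = h")
  case False
  then obtain i j where "i < length g" "length f = length g" "f ! i < g ! i" "\<forall>p<i. f ! p = g ! p"
    and "j < length h" "length g = length h" "g ! j < h ! j" "\<forall>p<j. g ! p = h ! p"
    using assms by (auto simp: lex_le_def)
  then have "min i j < length h \<and> f ! min i j < h ! min i j \<and> (\<forall>p<min i j. f ! p = h ! p)"
    by (cases i j rule: linorder_cases) (auto simp: min_def)
  then show ?thesis using \<open>length f = length g\<close> \<open>length g = length h\<close> unfolding lex_le_def by metis
qed (use assms in auto)

text \<open>Before the first occurrence of \<open>i\<close> an ordered surjection takes only values below \<open>i\<close>.\<close>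

lemma lex_le_precompose:
  assumes f: "f \<in> ordered_surj n m" and g: "g \<in> ordered_surj n m" and h: "h \<in> ordered_surj m k"
    and le: "lex_le f g" and ne: "f \<noteq> g"
  shows "lex_le (map ((!) f) h) (map ((!) g) h)" and "map ((!) f) h \<noteq> map ((!) g) h"
proof -
  note hD = ordered_surjD[OF h]
  obtain i where i: "i < m" "f ! i < g ! i" "\<And>j. j < i \<Longrightarrow> f ! j = g ! j"
    using le ne ordered_surjD(1)[OF g] by (auto simp: lex_le_def)
  \<comment> \<open>Here \<open>i\<close> is the first difference of \<open>f\<close> and
    \<open>g\<close>; the first place \<open>p\<close> where \<open>h\<close> takes the value
    \<open>i\<close> becomes the first difference of the composites.\<close>
  obtain p where p: "p < k" "h ! p = i" "i \<notin> set (take p h)"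
    using ex_first_occurrence[of i h] hD i(1) by auto
  have h_not: "h ! q \<noteq> i" if "q < p" for q
    using p(1,3) that hD(1) by (auto simp: in_set_conv_nth)
  have h_less: "h ! q < i" if q: "q < p" for q
  proof (rule ccontr)
    assume "\<not> h ! q < i"
    then have "i < h ! q" using h_not[OF q] by simp
    then obtain q' where "q' < q" "h ! q' = i" using hD(4)[of q i] q p(1) by auto
    then show False using h_not[of q'] q by simp
  qed
  show "lex_le (map ((!) f) h) (map ((!) g) h)"
    unfolding lex_le_def
  proof (intro disjI2 exI[of _ p] conjI allI impI)
    show "map ((!) f) h ! q = map ((!) g) h ! q" if "q < p" for q
      using i(3)[OF h_less[OF that]] that p(1) hD(1) by simp
  qed (use p i hD(1) in simp_all)
  have "map ((!) f) h ! p \<noteq> map ((!) g) h ! p" using p i hD(1) by simp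
  then show "map ((!) f) h \<noteq> map ((!) g) h" by metis
qed

lemma well_orderable_OS_op: "well_orderable_out (OS_op A) x"
proof -
  define r where "r y = {(list_encode f, list_encode g) | f g.
      f \<in> ordered_surj x y \<and> g \<in> ordered_surj x y \<and> lex_le f g}" for y
  have r_iff: "(list_encode f, list_encode g) \<in> r y \<longleftrightarrow>
      f \<in> ordered_surj x y \<and> g \<in> ordered_surj x y \<and> lex_le f g" for f g y
    by (auto simp: r_def list_encode_eq)
  have wo: "well_order_on (Mor (OS_op A) x y) (r y)" for y
  proof -
    have "linear_order_on (Mor (OS_op A) x y) (r y)"
      unfolding linear_order_on_def partial_order_on_def preorder_on_def
    proof (intro conjI)
      show "r y \<subseteq> Mor (OS_op A) x y \<times> Mor (OS_op A) x y" by (auto simp: r_def)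
      show "refl_on (Mor (OS_op A) x y) (r y)"
        by (auto simp: refl_on_def r_iff lex_le_def)
      show "trans (r y)"
        unfolding trans_def using lex_le_trans by (fastforce simp: r_def list_encode_eq)
      show "antisym (r y)"
        unfolding antisym_def using lex_le_antisym by (auto simp: r_def list_encode_eq)
      show "total_on (Mor (OS_op A) x y) (r y)"
        unfolding total_on_def using lex_le_linear by (auto simp: r_iff ordered_surj_def)
    qed
    \<comment> \<open>Hom-sets are finite, and a finite linear order is a well-order.\<close>
    moreover have "finite (r y)"
      by (rule finite_subset[of _ "Mor (OS_op A) x y \<times> Mor (OS_op A) x y"])
         (auto simp: r_def finite_ordered_surj)
    ultimately show ?thesis by (simp add: linear_order_on_well_order_on)
  qed
  show ?thesis
    unfolding well_orderable_out_def
  proof (intro exI[of _ r] conjI ballI impI)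
    fix y z h f g
    assume h: "h \<in> Mor (OS_op A) y z" and f: "f \<in> Mor (OS_op A) x y" and g: "g \<in> Mor (OS_op A) x y"
      and fg: "(f, g) \<in> r y \<and> f \<noteq> g"
    obtain h' f' g' where *: "h = list_encode h'" "f = list_encode f'" "g = list_encode g'"
      "h' \<in> ordered_surj y z" "f' \<in> ordered_surj x y" "g' \<in> ordered_surj x y"
      using h f g by auto
    have le: "lex_le f' g'" "f' \<noteq> g'" using fg unfolding *(1-3) r_iff by auto
    from lex_le_precompose[OF *(5,6,4) le]
    show "(Cmp (OS_op A) x y z h f, Cmp (OS_op A) x y z h g) \<in> r z"
      "Cmp (OS_op A) x y z h f \<noteq> Cmp (OS_op A) x y z h g"
      using *(4-6) by (auto simp: *(1-3) r_iff list_encode_eq ordered_surj_compose)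
  qed (rule wo)
qed

text \<open>Comparable representatives suffice, because \<open>out_poset_le\<close> asks only for
  one comparable pair from the two classes. Reflexivity, by way of the identity, puts into each
  class the morphism that generates it.\<close>

lemma noetherian_out_poset:
  assumes C: "category C" and x: "x \<in> Ob C"
    and good: "\<And>s :: nat \<Rightarrow> _. range s \<subseteq> out_mor C x \<Longrightarrow> \<exists>i j. i < j \<and> out_le C x (s i) (s j)"
  shows "noetherian_poset (out_poset C x) (out_poset_le C x)"
  unfolding noetherian_poset_def
proof (intro allI impI)
  fix s :: "nat \<Rightarrow> _" assume s: "\<forall>n. s n \<in> out_poset C x"
  have "\<exists>p. p \<in> s n \<and> p \<in> out_mor C x" for n
  proof -
    obtain y f where yf: "(y, f) \<in> out_mor C x" "s n = out_equiv C x `` {(y, f)}"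
      using s unfolding out_poset_def by (metis quotientE surj_pair)
    have "out_le C x (y, f) (y, f)"
      using yf(1) category.Idm_Cmp[OF C x, of y f] category.Idm_in[OF C, of y]
      by (auto simp: out_le_def out_mor_def intro!: bexI[of _ "Idm C y"])
    then show ?thesis using yf by (intro exI[of _ "(y, f)"]) (auto simp: out_equiv_def)
  qed
  then obtain p where p: "\<And>n. p n \<in> s n" "\<And>n. p n \<in> out_mor C x" by atomize_elim (metis)
  from good[of p] p(2) obtain i j where "i < j" "out_le C x (p i) (p j)" by blast
  then show "\<exists>i j. i < j \<and> out_poset_le C x (s i) (s j)"
    using p(1) unfolding out_poset_le_def by blast
qed

theorem groebner_OS_op: "groebner (OS_op A)"
  unfolding groebner_def
proof (intro conjI ballI category_OS_op well_orderable_OS_op)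
  fix x assume "x \<in> Ob (OS_op A)"
  then show "noetherian_poset (out_poset (OS_op A) x) (out_poset_le (OS_op A) x)"
  proof (rule noetherian_out_poset[OF category_OS_op])
    fix s :: "nat \<Rightarrow> nat \<times> nat" assume s: "range s \<subseteq> out_mor (OS_op A) x"
    have "\<exists>w \<in> ordered_surj x (fst (s n)). snd (s n) = list_encode w" for n
    proof -
      have "s n \<in> out_mor (OS_op A) x" using s by blast
      then show ?thesis by (auto simp: out_mor_def)
    qed
    then obtain w where w: "\<And>n. w n \<in> ordered_surj x (fst (s n))"
      "\<And>n. snd (s n) = list_encode (w n)" by metis
    \<comment> \<open>With the source \<open>x\<close> fixed, all marked words share one finite
      alphabet, whose second factor is \<open>bool\<close>.\<close>
    have "set (mark (w n)) \<subseteq> {..<x} \<times> UNIV" for n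
      using ordered_surjD(1,3)[OF w(1)[of n]] by (auto simp: mark_def)
    then have "range (\<lambda>n. mark (w n)) \<subseteq> lists ({..<x} \<times> UNIV)" by (auto simp: lists_eq_set)
    from higman[OF _ this] obtain i j where ij: "i < j" "subseq (mark (w i)) (mark (w j))" by auto
    obtain h where h: "h \<in> ordered_surj (fst (s i)) (fst (s j))" "w j = map ((!) (w i)) h"
      using subseq_mark_factorization[OF w(1) w(1) ij(2)] by blast
    have "out_le (OS_op A) x (s i) (s j)"
      using h by (auto simp: out_le_def case_prod_unfold w(2) intro!: bexI[of _ "list_encode h"])
    then show "\<exists>i j. i < j \<and> out_le (OS_op A) x (s i) (s j)" using ij(1) by blast
  qed
qed

section \<open>Splittable maps and coordinates\<close>

lemma linear_maps_minus:
  assumes "module R M" "module R N" "f \<in> linear_maps R M N" and v: "v \<in> carrier M"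
  shows "f (\<ominus>\<^bsub>M\<^esub> v) = \<ominus>\<^bsub>N\<^esub> f v"
proof -
  interpret M: module R M by fact
  interpret N: module R N by fact
  note f = linear_mapsD[OF assms(3)]
  have "f (\<ominus>\<^bsub>M\<^esub> v) \<oplus>\<^bsub>N\<^esub> f v = f (\<ominus>\<^bsub>M\<^esub> v \<oplus>\<^bsub>M\<^esub> v)"
    using v by (simp add: f(3))
  also have "\<dots> = \<zero>\<^bsub>N\<^esub>"
    using v by (simp add: M.l_neg linear_maps_zero[OF assms(1-3)])
  finally show ?thesis
    using v f(2) by (simp add: N.minus_equality)
qed

text \<open>Serves twice to produce complements: as the kernel of a left inverse, and as the
  preimage of a complement under an injection.\<close>

lemma submodule_preimage:
  assumes MN: "module R M" "module R N" and f: "f \<in> linear_maps R M N" and K: "submodule K R N"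
  shows "submodule {v \<in> carrier M. f v \<in> K} R M"
proof -
  interpret M: module R M by fact
  interpret N: module R N by fact
  note fD = linear_mapsD[OF f] and KE = N.submoduleE[OF K]
  have "\<zero>\<^bsub>N\<^esub> \<in> K"
    using subgroup.one_closed[of K "add_monoid N"] K by (simp add: submodule_def)
  then show ?thesis
    by (intro M.submoduleI)
      (auto simp: fD linear_maps_zero[OF MN f] linear_maps_minus[OF MN f] KE)
qed

lemma submodule_zero:
  assumes "module R M" shows "submodule {\<zero>\<^bsub>M\<^esub>} R M"
proof -
  interpret M: module R M by fact
  show ?thesis by (rule M.submoduleI) auto
qed

text \<open>The kernel of \<open>s\<close> is a complement of the image of \<open>g\<close>: every
  \<open>v\<close> is the sum of \<open>g (s v)\<close> and \<open>v\<close> minus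
  \<open>g (s v)\<close>.\<close>

lemma left_invertible_splittable:
  assumes MN: "module R M" "module R N" and g: "g \<in> linear_maps R M N"
    and s: "s \<in> linear_maps R N M" and sg: "\<And>u. u \<in> carrier M \<Longrightarrow> s (g u) = u"
  shows "g \<in> splittable_maps R M N" and "inj_on g (carrier M)"
proof -
  interpret M: module R M by fact
  interpret N: module R N by fact
  note gD = linear_mapsD[OF g] and sD = linear_mapsD[OF s]
  show "inj_on g (carrier M)" using sg by (rule inj_on_inverseI)
  let ?K = "{v \<in> carrier N. s v \<in> {\<zero>\<^bsub>M\<^esub>}}"
  have K: "submodule ?K R N"
    by (rule submodule_preimage[OF MN(2,1) s submodule_zero[OF MN(1)]])
  have img: "submodule (g ` carrier M) R N"
    by (rule submodule_image[OF MN g M.carrier_is_submodule])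
  note zero = linear_maps_zero[OF MN g] linear_maps_zero[OF MN(2,1) s]
  have "g u = \<zero>\<^bsub>N\<^esub>" if "u \<in> carrier M" "g u \<in> ?K" for u
    using that sg[OF that(1)] zero(1) by simp
  moreover have "\<zero>\<^bsub>N\<^esub> \<in> g ` carrier M" "\<zero>\<^bsub>N\<^esub> \<in> ?K"
    using zero M.zero_closed by (metis image_eqI, simp)
  ultimately have "g ` carrier M \<inter> ?K = {\<zero>\<^bsub>N\<^esub>}" by blast
  moreover have "g ` carrier M <+>\<^bsub>N\<^esub> ?K = carrier N"
  proof (intro subset_antisym subsetI)
    fix v assume v: "v \<in> carrier N"
    have gs: "g (s v) \<in> carrier N" using v gD(2) sD(2) by simp
    have "s (v \<oplus>\<^bsub>N\<^esub> \<ominus>\<^bsub>N\<^esub> g (s v)) = s v \<oplus>\<^bsub>M\<^esub> \<ominus>\<^bsub>M\<^esub> s v"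
      using v gs by (simp add: sD linear_maps_minus[OF MN(2,1) s] sg)
    then have "v \<oplus>\<^bsub>N\<^esub> \<ominus>\<^bsub>N\<^esub> g (s v) \<in> ?K" using v gs sD(2) by (simp add: M.r_neg)
    moreover have "v = g (s v) \<oplus>\<^bsub>N\<^esub> (v \<oplus>\<^bsub>N\<^esub> \<ominus>\<^bsub>N\<^esub> g (s v))"
      using v gs by (simp add: N.a_lcomm N.r_neg)
    ultimately show "v \<in> g ` carrier M <+>\<^bsub>N\<^esub> ?K"
      using sD(2)[OF v] unfolding set_add_def' by blast
  qed (auto simp: set_add_def' gD)
  ultimately show "g \<in> splittable_maps R M N"
    unfolding splittable_maps_def direct_summand_def using g K img by blast
qed

text \<open>The modular law: a complement of the image of \<open>g \<circ> f\<close> pulls back along \<open>g\<close> to a complement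
  of the image of \<open>f\<close>.\<close>

lemma splittable_factor:
  assumes mod: "module R L" "module R M" "module R N"
    and f: "f \<in> linear_maps R L M" and g: "g \<in> linear_maps R M N" and inj: "inj_on g (carrier M)"
    and gf: "compose (carrier L) g f \<in> splittable_maps R L N"
  shows "f \<in> splittable_maps R L M"
proof -
  interpret L: module R L by fact
  interpret M: module R M by fact
  interpret N: module R N by fact
  note gD = linear_mapsD[OF g] and fD = linear_mapsD[OF f]
  have "compose (carrier L) g f ` carrier L = (\<lambda>u. g (f u)) ` carrier L"
    by (auto simp: compose_def)
  then obtain K where K: "submodule K R N" "(\<lambda>u. g (f u)) ` carrier L \<inter> K = {\<zero>\<^bsub>N\<^esub>}"
    "(\<lambda>u. g (f u)) ` carrier L <+>\<^bsub>N\<^esub> K = carrier N"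
    using gf by (auto simp: splittable_maps_def direct_summand_def)
  let ?K = "{v \<in> carrier M. g v \<in> K}"
  have K': "submodule ?K R M" by (rule submodule_preimage[OF mod(2,3) g K(1)])
  have img: "submodule (f ` carrier L) R M"
    by (rule submodule_image[OF mod(1,2) f L.carrier_is_submodule])
  have "v = \<zero>\<^bsub>M\<^esub>" if "v \<in> f ` carrier L" "v \<in> ?K" for v
  proof -
    have "g v = \<zero>\<^bsub>N\<^esub>" using that K(2) by blast
    then have "g v = g \<zero>\<^bsub>M\<^esub>" using linear_maps_zero[OF mod(2,3) g] by simp
    then show ?thesis using inj that(2) by (auto dest: inj_onD)
  qed
  moreover have "\<zero>\<^bsub>M\<^esub> \<in> H" if "submodule H R M" for H
    using subgroup.one_closed[of H "add_monoid M"] that by (simp add: submodule_def)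
  ultimately have "f ` carrier L \<inter> ?K = {\<zero>\<^bsub>M\<^esub>}"
    using img K' by blast
  moreover have "f ` carrier L <+>\<^bsub>M\<^esub> ?K = carrier M"
  proof (intro subset_antisym subsetI)
    fix v assume v: "v \<in> carrier M"
    then have "g v \<in> (\<lambda>u. g (f u)) ` carrier L <+>\<^bsub>N\<^esub> K" using gD(2) K(3) by simp
    then obtain u k where uk: "u \<in> carrier L" "k \<in> K" "g v = g (f u) \<oplus>\<^bsub>N\<^esub> k"
      by (auto simp: set_add_def')
    have fu: "f u \<in> carrier M" and k: "k \<in> carrier N"
      using uk fD(2) N.submoduleE(1)[OF K(1)] by auto
    \<comment> \<open>The component of \<open>g v\<close> in \<open>K\<close> is itself a value of
      \<open>g\<close>, taken at \<open>v\<close> minus \<open>f u\<close>, so this difference lies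
      in the preimage of \<open>K\<close>.\<close>
    have "g (v \<oplus>\<^bsub>M\<^esub> \<ominus>\<^bsub>M\<^esub> f u) = g (f u) \<oplus>\<^bsub>N\<^esub> k \<oplus>\<^bsub>N\<^esub> \<ominus>\<^bsub>N\<^esub> g (f u)"
      using v fu by (simp add: gD(3) linear_maps_minus[OF mod(2,3) g] uk(3))
    also have "\<dots> = k"
      using k gD(2)[OF fu] by (simp add: N.a_ac N.r_neg)
    finally have "v \<oplus>\<^bsub>M\<^esub> \<ominus>\<^bsub>M\<^esub> f u \<in> ?K" using v fu uk(2) by simp
    moreover have "v = f u \<oplus>\<^bsub>M\<^esub> (v \<oplus>\<^bsub>M\<^esub> \<ominus>\<^bsub>M\<^esub> f u)"
      using v fu by (simp add: M.a_lcomm M.r_neg)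
    ultimately show "v \<in> f ` carrier L <+>\<^bsub>M\<^esub> ?K"
      using uk(1) unfolding set_add_def' by blast
  qed (auto simp: set_add_def' fD)
  ultimately show ?thesis
    unfolding splittable_maps_def direct_summand_def using f K' img by blast
qed

text \<open>An isomorphism of \<open>M\<close> with R^n, given by extensional functions so that R^n
  need not be a module on the element type of \<open>M\<close>. Over the zero ring every module has
  coordinates of every length.\<close>

definition coordinates ::
  "('a, 'r) ring_scheme \<Rightarrow> ('a, 'b) module \<Rightarrow> nat \<Rightarrow> ('b \<Rightarrow> nat \<Rightarrow> 'a) \<Rightarrow> bool" where
  "coordinates R M n \<kappa> \<longleftrightarrow> bij_betw \<kappa> (carrier M) ({..<n} \<rightarrow>\<^sub>E carrier R) \<and>
     (\<forall>u \<in> carrier M. \<forall>v \<in> carrier M. \<forall>i<n. \<kappa> (u \<oplus>\<^bsub>M\<^esub> v) i = \<kappa> u i \<oplus>\<^bsub>R\<^esub> \<kappa> v i) \<and>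
     (\<forall>a \<in> carrier R. \<forall>v \<in> carrier M. \<forall>i<n. \<kappa> (a \<odot>\<^bsub>M\<^esub> v) i = a \<otimes>\<^bsub>R\<^esub> \<kappa> v i)"

lemma coordinatesD:
  assumes "coordinates R M n \<kappa>"
  shows "bij_betw \<kappa> (carrier M) ({..<n} \<rightarrow>\<^sub>E carrier R)"
    and "\<And>u. u \<in> carrier M \<Longrightarrow> \<kappa> u \<in> {..<n} \<rightarrow>\<^sub>E carrier R"
    and "\<And>u i. u \<in> carrier M \<Longrightarrow> i < n \<Longrightarrow> \<kappa> u i \<in> carrier R"
    and "\<And>u v i. u \<in> carrier M \<Longrightarrow> v \<in> carrier M \<Longrightarrow> i < n \<Longrightarrow>
      \<kappa> (u \<oplus>\<^bsub>M\<^esub> v) i = \<kappa> u i \<oplus>\<^bsub>R\<^esub> \<kappa> v i"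
    and "\<And>a v i. a \<in> carrier R \<Longrightarrow> v \<in> carrier M \<Longrightarrow> i < n \<Longrightarrow>
      \<kappa> (a \<odot>\<^bsub>M\<^esub> v) i = a \<otimes>\<^bsub>R\<^esub> \<kappa> v i"
proof -
  show "bij_betw \<kappa> (carrier M) ({..<n} \<rightarrow>\<^sub>E carrier R)"
    using assms by (simp add: coordinates_def)
  then show *: "\<kappa> u \<in> {..<n} \<rightarrow>\<^sub>E carrier R" if "u \<in> carrier M" for u
    using that by (rule bij_betw_apply)
  show "\<kappa> u i \<in> carrier R" if "u \<in> carrier M" "i < n" for u i
    using *[OF that(1)] that(2) by auto
qed (use assms in \<open>simp_all add: coordinates_def\<close>)

lemma coordinates_eqI:
  assumes "coordinates R M n \<kappa>" "u \<in> carrier M" "v \<in> carrier M"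
    and "\<And>i. i < n \<Longrightarrow> \<kappa> u i = \<kappa> v i"
  shows "u = v"
proof -
  note \<kappa> = coordinatesD[OF assms(1)]
  have "\<kappa> u = \<kappa> v"
    using PiE_ext[OF \<kappa>(2)[OF assms(2)] \<kappa>(2)[OF assms(3)]] assms(4) by simp
  then show ?thesis using bij_betw_imp_inj_on[OF \<kappa>(1)] assms(2,3) by (auto dest: inj_onD)
qed

lemma coordinates_zero:
  assumes "module R M" "coordinates R M n \<kappa>" "i < n"
  shows "\<kappa> \<zero>\<^bsub>M\<^esub> i = \<zero>\<^bsub>R\<^esub>"
proof -
  interpret M: module R M by fact
  note \<kappa> = coordinatesD[OF assms(2)]
  have "\<kappa> \<zero>\<^bsub>M\<^esub> i = \<kappa> (\<zero>\<^bsub>R\<^esub> \<odot>\<^bsub>M\<^esub> \<zero>\<^bsub>M\<^esub>) i" by simp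
  also have "\<dots> = \<zero>\<^bsub>R\<^esub> \<otimes>\<^bsub>R\<^esub> \<kappa> \<zero>\<^bsub>M\<^esub> i" by (rule \<kappa>(5)) (use assms(3) in auto)
  also have "\<dots> = \<zero>\<^bsub>R\<^esub>" using \<kappa>(3)[of "\<zero>\<^bsub>M\<^esub>" i] assms(3) by simp
  finally show ?thesis .
qed

text \<open>With \<open>N\<close> identified with R^n by \<open>\<kappa>\<close>, this is the map
  given by a tuple of \<open>n\<close> forms \<open>\<phi>\<close>.\<close>

definition coord_map ::
  "('a, 'b) module \<Rightarrow> ('a, 'b) module \<Rightarrow> nat \<Rightarrow> ('b \<Rightarrow> nat \<Rightarrow> 'a) \<Rightarrow> ('b \<Rightarrow> nat \<Rightarrow> 'a) \<Rightarrow> 'b \<Rightarrow> 'b"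
  where "coord_map M N n \<kappa> \<phi> = (\<lambda>u \<in> carrier M. inv_into (carrier N) \<kappa> (\<lambda>i \<in> {..<n}. \<phi> u i))"

lemma coord_map:
  assumes \<kappa>: "coordinates R N n \<kappa>" and u: "u \<in> carrier M"
    and \<phi>: "\<And>i. i < n \<Longrightarrow> \<phi> u i \<in> carrier R"
  shows "coord_map M N n \<kappa> \<phi> u \<in> carrier N"
    and "\<And>i. i < n \<Longrightarrow> \<kappa> (coord_map M N n \<kappa> \<phi> u) i = \<phi> u i"
proof -
  have \<phi>u: "(\<lambda>i \<in> {..<n}. \<phi> u i) \<in> \<kappa> ` carrier N"
    using \<phi> bij_betw_imp_surj_on[OF coordinatesD(1)[OF \<kappa>]] by auto
  from inv_into_into[OF this] show "coord_map M N n \<kappa> \<phi> u \<in> carrier N"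
    using u by (simp add: coord_map_def)
  from f_inv_into_f[OF \<phi>u]
  show "\<kappa> (coord_map M N n \<kappa> \<phi> u) i = \<phi> u i" if "i < n" for i
    using u that by (simp add: coord_map_def)
qed

lemma coord_map_linear:
  assumes mod: "module R M" "module R N" and \<kappa>: "coordinates R N n \<kappa>"
    and \<phi>: "\<And>u i. u \<in> carrier M \<Longrightarrow> i < n \<Longrightarrow> \<phi> u i \<in> carrier R"
    "\<And>u v i. u \<in> carrier M \<Longrightarrow> v \<in> carrier M \<Longrightarrow> i < n \<Longrightarrow> \<phi> (u \<oplus>\<^bsub>M\<^esub> v) i = \<phi> u i \<oplus>\<^bsub>R\<^esub> \<phi> v i"
    "\<And>a v i. a \<in> carrier R \<Longrightarrow> v \<in> carrier M \<Longrightarrow> i < n \<Longrightarrow> \<phi> (a \<odot>\<^bsub>M\<^esub> v) i = a \<otimes>\<^bsub>R\<^esub> \<phi> v i"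
  shows "coord_map M N n \<kappa> \<phi> \<in> linear_maps R M N"
proof -
  interpret M: module R M by fact
  interpret N: module R N by fact
  note \<kappa>D = coordinatesD[OF \<kappa>]
  let ?f = "coord_map M N n \<kappa> \<phi>"
  have f: "?f u \<in> carrier N" "\<And>i. i < n \<Longrightarrow> \<kappa> (?f u) i = \<phi> u i" if "u \<in> carrier M" for u
    using coord_map[where \<phi> = \<phi> and M = M, OF \<kappa> that \<phi>(1)[OF that]] by auto
  have "?f \<in> extensional (carrier M)" by (simp add: coord_map_def)
  moreover have "?f (u \<oplus>\<^bsub>M\<^esub> v) = ?f u \<oplus>\<^bsub>N\<^esub> ?f v" if "u \<in> carrier M" "v \<in> carrier M" for u v
    by (rule coordinates_eqI[OF \<kappa>]) (use that in \<open>simp_all add: f \<kappa>D(4) \<phi>(2)\<close>)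
  moreover have "?f (a \<odot>\<^bsub>M\<^esub> v) = a \<odot>\<^bsub>N\<^esub> ?f v" if "a \<in> carrier R" "v \<in> carrier M" for a v
    by (rule coordinates_eqI[OF \<kappa>]) (use that in \<open>simp_all add: f \<kappa>D(5) \<phi>(3)\<close>)
  ultimately show ?thesis
    by (auto simp: linear_maps_def PiE_def f)
qed

lemma coordinates_finsum:
  assumes "module R M" "coordinates R M n \<kappa>" "i < n" "finite B" "f \<in> B \<rightarrow> carrier M"
  shows "\<kappa> (\<Oplus>\<^bsub>M\<^esub> b \<in> B. f b) i = (\<Oplus>\<^bsub>R\<^esub> b \<in> B. \<kappa> (f b) i)"
  using assms(4,5)
proof (induction rule: finite_induct)
  interpret M: module R M by fact
  case empty
  then show ?case using coordinates_zero[OF assms(1-3)] by simp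
next
  interpret M: module R M by fact
  note \<kappa> = coordinatesD[OF assms(2)]
  case (insert b B)
  have "(\<lambda>b. \<kappa> (f b) i) \<in> B \<rightarrow> carrier R" using insert.prems \<kappa>(3) assms(3) by auto
  then show ?case using insert assms(3) by (simp add: Pi_iff \<kappa>(3,4))
qed

text \<open>For a nonzero ring the preimages \<open>e j\<close> of the unit vectors form a basis:
  the coefficient of \<open>e i\<close> in a combination is its coordinate at \<open>i\<close>,
  which gives both existence and uniqueness.\<close>

lemma coordinates_imp_free:
  assumes "module R M" and \<kappa>: "coordinates R M n \<kappa>"
  shows "free_finite_rank R M"
proof (cases "\<one>\<^bsub>R\<^esub> = \<zero>\<^bsub>R\<^esub>")
  case True
  interpret M: module R M by fact
  \<comment> \<open>Over the zero ring the unit vectors coincide, so they are not a basis of \<open>n\<close> elements.\<close>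
  have "v = \<zero>\<^bsub>M\<^esub>" if "v \<in> carrier M" for v
    using that True M.smult_l_null M.smult_one by metis
  then have "is_basis R M {}"
    by (auto simp: is_basis_def)
  then show ?thesis using assms(1) unfolding free_finite_rank_def by blast
next
  case False
  interpret M: module R M by fact
  note \<kappa>D = coordinatesD[OF \<kappa>]
  define e where "e j = inv_into (carrier M) \<kappa> (\<lambda>i \<in> {..<n}. if j = i then \<one>\<^bsub>R\<^esub> else \<zero>\<^bsub>R\<^esub>)" for j
  have mem: "(\<lambda>i \<in> {..<n}. if j = i then \<one>\<^bsub>R\<^esub> else \<zero>\<^bsub>R\<^esub>) \<in> \<kappa> ` carrier M" for j
    using bij_betw_imp_surj_on[OF \<kappa>D(1)] by auto
  have e: "e j \<in> carrier M" and \<kappa>_e: "i < n \<Longrightarrow> \<kappa> (e j) i = (if j = i then \<one>\<^bsub>R\<^esub> else \<zero>\<^bsub>R\<^esub>)" for i j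
    using inv_into_into[OF mem, of j] f_inv_into_f[OF mem, of j] by (simp_all add: e_def)
  have inj: "inj_on e {..<n}"
  proof (rule inj_onI)
    fix i j assume "i \<in> {..<n}" "j \<in> {..<n}" "e i = e j"
    then show "i = j" using \<kappa>_e[of j j] \<kappa>_e[of j i] False by (auto split: if_splits)
  qed
  have sum: "\<kappa> (\<Oplus>\<^bsub>M\<^esub> b \<in> e ` {..<n}. c b \<odot>\<^bsub>M\<^esub> b) i = c (e i)"
    if c: "c \<in> e ` {..<n} \<rightarrow>\<^sub>E carrier R" and i: "i < n" for c i
  proof -
    have cR: "c (e j) \<in> carrier R" if "j < n" for j using c that by auto
    have "(\<Oplus>\<^bsub>M\<^esub> b \<in> e ` {..<n}. c b \<odot>\<^bsub>M\<^esub> b) = (\<Oplus>\<^bsub>M\<^esub> j \<in> {..<n}. c (e j) \<odot>\<^bsub>M\<^esub> e j)"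
      by (rule M.finsum_reindex) (use cR e inj in auto)
    then have "\<kappa> (\<Oplus>\<^bsub>M\<^esub> b \<in> e ` {..<n}. c b \<odot>\<^bsub>M\<^esub> b) i = (\<Oplus>\<^bsub>R\<^esub> j \<in> {..<n}. \<kappa> (c (e j) \<odot>\<^bsub>M\<^esub> e j) i)"
      using coordinates_finsum[OF assms i, of "{..<n}" "\<lambda>j. c (e j) \<odot>\<^bsub>M\<^esub> e j"] cR e by auto
    also have "\<dots> = (\<Oplus>\<^bsub>R\<^esub> j \<in> {..<n}. if i = j then c (e j) else \<zero>\<^bsub>R\<^esub>)"
      by (rule M.R.finsum_cong') (use cR e \<kappa>D(5) \<kappa>_e i in auto)
    also have "\<dots> = c (e i)"
      by (rule M.R.finsum_singleton) (use cR i in auto)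
    finally show ?thesis .
  qed
  have sum_closed: "(\<Oplus>\<^bsub>M\<^esub> b \<in> e ` {..<n}. c b \<odot>\<^bsub>M\<^esub> b) \<in> carrier M"
    if "c \<in> e ` {..<n} \<rightarrow>\<^sub>E carrier R" for c
    by (rule M.finsum_closed) (use that e in auto)
  have "is_basis R M (e ` {..<n})"
    unfolding is_basis_def
  proof (intro conjI ballI ex_ex1I)
    show "e ` {..<n} \<subseteq> carrier M" using e by auto
    fix v assume v: "v \<in> carrier M"
    let ?c = "\<lambda>b \<in> e ` {..<n}. \<kappa> v (inv_into {..<n} e b)"
    have c: "?c \<in> e ` {..<n} \<rightarrow>\<^sub>E carrier R"
      using \<kappa>D(3)[OF v] by (auto simp: inv_into_f_f[OF inj])
    have "v = (\<Oplus>\<^bsub>M\<^esub> b \<in> e ` {..<n}. ?c b \<odot>\<^bsub>M\<^esub> b)"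
      by (rule coordinates_eqI[OF \<kappa> v sum_closed[OF c]])
        (simp only: sum[OF c], simp add: inv_into_f_f[OF inj])
    then show "\<exists>c. c \<in> e ` {..<n} \<rightarrow>\<^sub>E carrier R \<and> v = (\<Oplus>\<^bsub>M\<^esub> b \<in> e ` {..<n}. c b \<odot>\<^bsub>M\<^esub> b)"
      using c by blast
    fix c d
    assume c: "c \<in> e ` {..<n} \<rightarrow>\<^sub>E carrier R \<and> v = (\<Oplus>\<^bsub>M\<^esub> b \<in> e ` {..<n}. c b \<odot>\<^bsub>M\<^esub> b)"
      and d: "d \<in> e ` {..<n} \<rightarrow>\<^sub>E carrier R \<and> v = (\<Oplus>\<^bsub>M\<^esub> b \<in> e ` {..<n}. d b \<odot>\<^bsub>M\<^esub> b)"
    have "c (e i) = d (e i)" if "i < n" for i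
      using sum[OF conjunct1[OF c] that] sum[OF conjunct1[OF d] that] c d by metis
    then show "c = d"
      using PiE_ext[OF conjunct1[OF c] conjunct1[OF d]] by blast
  qed
  then show ?thesis using assms(1) unfolding free_finite_rank_def by blast
qed

text \<open>Linearity of the coefficient family comes from uniqueness: the pointwise sum of
  \<open>c u\<close> and \<open>c v\<close> represents the sum of \<open>u\<close> and
  \<open>v\<close>, hence is its coefficient family; scalar multiples are treated alike.\<close>

lemma free_imp_coordinates:
  assumes "free_finite_rank R M"
  shows "\<exists>n \<kappa>. coordinates R M n \<kappa>"
proof -
  obtain B where "module R M" and fin: "finite B" and B: "is_basis R M B"
    using assms unfolding free_finite_rank_def by blast
  interpret M: module R M by fact
  have B_sub: "b \<in> carrier M" if "b \<in> B" for b using B that by (auto simp: is_basis_def)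
  define comb where "comb c = (\<Oplus>\<^bsub>M\<^esub> b \<in> B. c b \<odot>\<^bsub>M\<^esub> b)" for c
  have ex1: "\<exists>!c. c \<in> B \<rightarrow>\<^sub>E carrier R \<and> v = comb c" if "v \<in> carrier M" for v
    using B that unfolding is_basis_def comb_def by blast
  define c where "c v = (THE c. c \<in> B \<rightarrow>\<^sub>E carrier R \<and> v = comb c)" for v
  have c: "c v \<in> B \<rightarrow>\<^sub>E carrier R" "comb (c v) = v" if "v \<in> carrier M" for v
    using theI'[OF ex1[OF that]] by (simp_all add: c_def)
  have c_eq: "c v = d" if "v \<in> carrier M" "d \<in> B \<rightarrow>\<^sub>E carrier R" "v = comb d" for v d
    using ex1[OF that(1)] c[OF that(1)] that by metis
  have comb_closed: "comb d \<in> carrier M" if "d \<in> B \<rightarrow>\<^sub>E carrier R" for d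
    unfolding comb_def by (rule M.finsum_closed) (use that B_sub in auto)
  have cR: "c v b \<in> carrier R" if "v \<in> carrier M" "b \<in> B" for v b
    using c(1)[OF that(1)] that(2) by auto
  have c_add: "c (u \<oplus>\<^bsub>M\<^esub> v) b = c u b \<oplus>\<^bsub>R\<^esub> c v b"
    if u: "u \<in> carrier M" and v: "v \<in> carrier M" and b: "b \<in> B" for u v b
  proof -
    let ?d = "\<lambda>b \<in> B. c u b \<oplus>\<^bsub>R\<^esub> c v b"
    have "comb ?d = (\<Oplus>\<^bsub>M\<^esub> b \<in> B. (c u b \<odot>\<^bsub>M\<^esub> b) \<oplus>\<^bsub>M\<^esub> (c v b \<odot>\<^bsub>M\<^esub> b))"
      unfolding comb_def
      by (rule M.finsum_cong') (use cR u v B_sub in \<open>auto simp: M.smult_l_distr\<close>)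
    also have "\<dots> = comb (c u) \<oplus>\<^bsub>M\<^esub> comb (c v)"
      unfolding comb_def by (rule M.finsum_addf) (use cR u v B_sub in auto)
    finally have *: "comb ?d = u \<oplus>\<^bsub>M\<^esub> v" using u v c by simp
    have "c (u \<oplus>\<^bsub>M\<^esub> v) = ?d"
      by (rule c_eq) (use u v in \<open>simp_all only: * restrict_PiE_iff\<close>, use u v cR in auto)
    then show ?thesis using b by simp
  qed
  have c_smult: "c (a \<odot>\<^bsub>M\<^esub> v) b = a \<otimes>\<^bsub>R\<^esub> c v b"
    if a: "a \<in> carrier R" and v: "v \<in> carrier M" and b: "b \<in> B" for a v b
  proof -
    let ?d = "\<lambda>b \<in> B. a \<otimes>\<^bsub>R\<^esub> c v b"
    have "comb ?d = (\<Oplus>\<^bsub>M\<^esub> b \<in> B. a \<odot>\<^bsub>M\<^esub> (c v b \<odot>\<^bsub>M\<^esub> b))"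
      unfolding comb_def
      by (rule M.finsum_cong') (use cR a v B_sub in \<open>auto simp: M.smult_assoc1\<close>)
    also have "\<dots> = a \<odot>\<^bsub>M\<^esub> comb (c v)"
      unfolding comb_def by (rule M.finsum_smult_ldistr[symmetric]) (use fin a cR v B_sub in auto)
    finally have *: "comb ?d = a \<odot>\<^bsub>M\<^esub> v" using v c by simp
    have "c (a \<odot>\<^bsub>M\<^esub> v) = ?d"
      by (rule c_eq) (use a v in \<open>simp_all only: * restrict_PiE_iff\<close>, use a v cR in auto)
    then show ?thesis using b by simp
  qed
  obtain h where h: "bij_betw h {0..<card B} B" using ex_bij_betw_nat_finite[OF fin] by blast
  have hB: "h i \<in> B" if "i < card B" for i using bij_betw_apply[OF h] that by simp
  define \<kappa> where "\<kappa> v = (\<lambda>i \<in> {..<card B}. c v (h i))" for v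
  define \<sigma> where "\<sigma> \<phi> = (\<lambda>b \<in> B. \<phi> (inv_into {0..<card B} h b) :: 'a)" for \<phi>
  have \<sigma>: "\<sigma> \<phi> \<in> B \<rightarrow>\<^sub>E carrier R" if "\<phi> \<in> {..<card B} \<rightarrow>\<^sub>E carrier R" for \<phi>
    using that bij_betw_apply[OF bij_betw_inv_into[OF h]] by (auto simp: \<sigma>_def)
  have "bij_betw \<kappa> (carrier M) ({..<card B} \<rightarrow>\<^sub>E carrier R)"
  proof (rule bij_betw_byWitness[where f' = "\<lambda>\<phi>. comb (\<sigma> \<phi>)"])
    show "\<forall>v \<in> carrier M. comb (\<sigma> (\<kappa> v)) = v"
    proof
      fix v assume v: "v \<in> carrier M"
      have "\<kappa> v \<in> {..<card B} \<rightarrow>\<^sub>E carrier R" using v cR hB by (auto simp: \<kappa>_def)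
      moreover have "\<sigma> (\<kappa> v) b = c v b" if "b \<in> B" for b
        using that bij_betw_apply[OF bij_betw_inv_into[OF h] that] bij_betw_inv_into_right[OF h that]
        by (simp add: \<sigma>_def \<kappa>_def)
      ultimately have "\<sigma> (\<kappa> v) = c v" using PiE_ext[OF \<sigma> c(1)[OF v]] by blast
      then show "comb (\<sigma> (\<kappa> v)) = v" using c(2)[OF v] by simp
    qed
    show "\<forall>\<phi> \<in> {..<card B} \<rightarrow>\<^sub>E carrier R. \<kappa> (comb (\<sigma> \<phi>)) = \<phi>"
    proof
      fix \<phi> assume \<phi>: "\<phi> \<in> {..<card B} \<rightarrow>\<^sub>E carrier R"
      have *: "c (comb (\<sigma> \<phi>)) = \<sigma> \<phi>" using c_eq comb_closed \<sigma>[OF \<phi>] by blast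
      show "\<kappa> (comb (\<sigma> \<phi>)) = \<phi>"
      proof (rule PiE_ext[OF _ \<phi>])
        show "\<kappa> (comb (\<sigma> \<phi>)) \<in> {..<card B} \<rightarrow>\<^sub>E carrier R"
          using \<sigma>[OF \<phi>] hB by (auto simp: \<kappa>_def *)
        show "\<kappa> (comb (\<sigma> \<phi>)) i = \<phi> i" if "i \<in> {..<card B}" for i
          using that hB bij_betw_inv_into_left[OF h, of i] unfolding \<kappa>_def * by (simp add: \<sigma>_def)
      qed
    qed
  qed (use cR hB comb_closed \<sigma> in \<open>simp_all add: \<kappa>_def image_subset_iff restrict_PiE_iff\<close>)
  then have "coordinates R M (card B) \<kappa>"
    using hB by (simp add: coordinates_def \<kappa>_def c_add c_smult)
  then show ?thesis by blast
qed

text \<open>Makes the set of realized ranks closed downwards without leaving the element type: the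
  elements whose last \<open>n - m\<close> coordinates vanish form the required module.\<close>

lemma coordinates_smaller:
  fixes M :: "('a, 'b) module"
  assumes "module R M" and \<kappa>: "coordinates R M n \<kappa>" and "m \<le> n"
  shows "\<exists>M' \<kappa>'. module R (M' :: ('a, 'b) module) \<and> coordinates R M' m \<kappa>'"
proof -
  interpret M: module R M by fact
  note \<kappa>D = coordinatesD[OF \<kappa>]
  define H where "H = {u \<in> carrier M. \<forall>i<n. m \<le> i \<longrightarrow> \<kappa> u i = \<zero>\<^bsub>R\<^esub>}"
  have smult: "a \<odot>\<^bsub>M\<^esub> u \<in> H" if "a \<in> carrier R" "u \<in> H" for a u
    using that by (auto simp: H_def \<kappa>D(5))
  have "submodule H R M"
  proof (rule M.submoduleI)
    show "\<zero>\<^bsub>M\<^esub> \<in> H" by (auto simp: H_def coordinates_zero[OF assms(1,2)])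
    show "\<ominus>\<^bsub>M\<^esub> u \<in> H" if "u \<in> H" for u
    proof -
      have "\<ominus>\<^bsub>M\<^esub> u = (\<ominus>\<^bsub>R\<^esub> \<one>\<^bsub>R\<^esub>) \<odot>\<^bsub>M\<^esub> u"
        using that by (simp add: H_def M.smult_l_minus)
      then show ?thesis using smult that by simp
    qed
  qed (use smult in \<open>auto simp: H_def \<kappa>D(4)\<close>)
  then have mod: "module R (M\<lparr>carrier := H\<rparr>)"
    by (rule submodule.submodule_is_module) fact
  let ?\<kappa> = "\<lambda>u. restrict (\<kappa> u) {..<m}"
  have "bij_betw ?\<kappa> H ({..<m} \<rightarrow>\<^sub>E carrier R)"
    unfolding bij_betw_def
  proof
    show "inj_on ?\<kappa> H"
    proof (rule inj_onI)
      fix u v assume uv: "u \<in> H" "v \<in> H" "?\<kappa> u = ?\<kappa> v"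
      show "u = v"
      proof (rule coordinates_eqI[OF \<kappa>])
        show "\<kappa> u i = \<kappa> v i" if "i < n" for i
          using fun_cong[OF uv(3), of i] uv(1,2) that by (cases "i < m") (auto simp: H_def)
      qed (use uv in \<open>auto simp: H_def\<close>)
    qed
    show "?\<kappa> ` H = {..<m} \<rightarrow>\<^sub>E carrier R"
    proof (intro subset_antisym subsetI)
      fix \<phi> assume \<phi>: "\<phi> \<in> {..<m} \<rightarrow>\<^sub>E carrier R"
      let ?\<psi> = "\<lambda>i \<in> {..<n}. if i < m then \<phi> i else \<zero>\<^bsub>R\<^esub>"
      have "\<phi> i \<in> carrier R" if "i < m" for i using PiE_mem[OF \<phi>] that by simp
      then have "?\<psi> \<in> {..<n} \<rightarrow>\<^sub>E carrier R" by (simp add: restrict_PiE_iff)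
      then obtain u where u: "u \<in> carrier M" "\<kappa> u = ?\<psi>"
        unfolding bij_betw_imp_surj_on[OF \<kappa>D(1), symmetric] by auto
      have "?\<kappa> u = \<phi>"
      proof (rule PiE_ext[OF _ \<phi>])
        show "?\<kappa> u \<in> {..<m} \<rightarrow>\<^sub>E carrier R"
          using \<kappa>D(3)[OF u(1)] \<open>m \<le> n\<close> by (simp add: restrict_PiE_iff)
        show "?\<kappa> u i = \<phi> i" if "i \<in> {..<m}" for i
          using that \<open>m \<le> n\<close> by (simp add: u(2))
      qed
      moreover have "u \<in> H" using u by (simp add: H_def)
      ultimately show "\<phi> \<in> ?\<kappa> ` H" by blast
    next
      fix \<phi> assume "\<phi> \<in> ?\<kappa> ` H"
      then show "\<phi> \<in> {..<m} \<rightarrow>\<^sub>E carrier R"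
        using \<kappa>D(3) \<open>m \<le> n\<close> by (elim imageE) (simp add: H_def restrict_PiE_iff)
    qed
  qed
  then have "coordinates R (M\<lparr>carrier := H\<rparr>) m ?\<kappa>"
    using \<kappa>D(4,5) \<open>m \<le> n\<close> by (simp add: coordinates_def H_def)
  then show ?thesis using mod by blast
qed

lemma finite_carrier_coordinates:
  assumes "finite (carrier R)" "coordinates R M n \<kappa>"
  shows "finite (carrier M)"
  using bij_betw_finite[OF coordinatesD(1)[OF assms(2)]] finite_PiE[of "{..<n}" "\<lambda>_. carrier R"]
    assms(1) by simp

text \<open>The flag \<open>q\<close> adds injectivity: \<open>True\<close> gives \<open>VI\<close>
  and \<open>False\<close> gives \<open>VA\<close>, so one argument serves both.\<close>

definition split_cat ::
  "bool \<Rightarrow> ('a, 'r) ring_scheme \<Rightarrow> (('a, 'b) module, 'b \<Rightarrow> 'b) cat" where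
  "split_cat q R = \<lparr>Ob = {M. free_finite_rank R M},
     Mor = (\<lambda>M N. {f \<in> splittable_maps R M N. q \<longrightarrow> inj_on f (carrier M)}),
     Cmp = (\<lambda>L M N g f. compose (carrier L) g f),
     Idm = (\<lambda>M. restrict id (carrier M))\<rparr>"

lemma split_cat_simps [simp]:
  "Ob (split_cat q R) = {M. free_finite_rank R M}"
  "Mor (split_cat q R) M N = {f \<in> splittable_maps R M N. q \<longrightarrow> inj_on f (carrier M)}"
  "Cmp (split_cat q R) L M N g f = compose (carrier L) g f"
  "Idm (split_cat q R) M = restrict id (carrier M)"
  by (simp_all add: split_cat_def)

lemma VI_eq_split_cat: "VI R = split_cat True R"
  by (simp add: VI_def split_cat_def)

lemma VA_eq_split_cat: "VA R = split_cat False R"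
  by (simp add: VA_def split_cat_def)

text \<open>Matching coordinates gives two linear maps, each a left inverse of the other, so both
  are splittable and injective whatever \<open>q\<close> is.\<close>

lemma iso_objects_coordinates:
  assumes mod: "module R M" "module R N" and \<kappa>: "coordinates R M n \<kappa>" and \<nu>: "coordinates R N n \<nu>"
  shows "iso_objects (split_cat q R) M N"
proof -
  note \<kappa>D = coordinatesD[OF \<kappa>] and \<nu>D = coordinatesD[OF \<nu>]
  let ?f = "coord_map M N n \<nu> \<kappa>" and ?g = "coord_map N M n \<kappa> \<nu>"
  have f: "?f \<in> linear_maps R M N" by (rule coord_map_linear[OF mod \<nu> \<kappa>D(3-5)])
  have g: "?g \<in> linear_maps R N M" by (rule coord_map_linear[OF mod(2,1) \<kappa> \<nu>D(3-5)])
  note fD = coord_map[where \<phi> = \<kappa> and M = M, OF \<nu> _ \<kappa>D(3)]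
    and gD = coord_map[where \<phi> = \<nu> and M = N, OF \<kappa> _ \<nu>D(3)]
  have gf: "?g (?f u) = u" if "u \<in> carrier M" for u
    by (rule coordinates_eqI[OF \<kappa>]) (use that in \<open>simp_all add: fD gD\<close>)
  have fg: "?f (?g v) = v" if "v \<in> carrier N" for v
    by (rule coordinates_eqI[OF \<nu>]) (use that in \<open>simp_all add: fD gD\<close>)
  have "compose (carrier M) ?g ?f = restrict id (carrier M)"
    "compose (carrier N) ?f ?g = restrict id (carrier N)"
    using gf fg by (auto simp: compose_def)
  moreover have "?f \<in> Mor (split_cat q R) M N" "?g \<in> Mor (split_cat q R) N M"
    using left_invertible_splittable[OF mod f g gf] left_invertible_splittable[OF mod(2,1) g f fg]
    by simp_all
  ultimately show ?thesis
    unfolding iso_objects_def by auto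
qed

section \<open>The functor from ordered surjections to free modules\<close>

locale coordinate_family =
  fixes R :: "('a, 'r) ring_scheme" and A :: "nat set"
    and F :: "nat \<Rightarrow> ('a, 'b) module" and \<kappa> :: "nat \<Rightarrow> 'b \<Rightarrow> nat \<Rightarrow> 'a"
  assumes module_F: "n \<in> A \<Longrightarrow> module R (F n)"
    and coords: "n \<in> A \<Longrightarrow> coordinates R (F n) n (\<kappa> n)"
begin

definition pull :: "nat \<Rightarrow> nat \<Rightarrow> nat \<Rightarrow> 'b \<Rightarrow> 'b" where
  "pull n m c = coord_map (F n) (F m) m (\<kappa> m) (\<lambda>u i. \<kappa> n u (list_decode c ! i))"

lemma
  assumes n: "n \<in> A" and m: "m \<in> A" and h: "h \<in> ordered_surj n m"
  shows pull_linear: "pull n m (list_encode h) \<in> linear_maps R (F n) (F m)"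
    and pull_coords: "\<And>u i. u \<in> carrier (F n) \<Longrightarrow> i < m \<Longrightarrow>
      \<kappa> m (pull n m (list_encode h) u) i = \<kappa> n u (h ! i)"
    and pull_splittable: "pull n m (list_encode h) \<in> splittable_maps R (F n) (F m)"
    and pull_inj: "inj_on (pull n m (list_encode h)) (carrier (F n))"
proof -
  let ?g = "pull n m (list_encode h)"
  note \<kappa>n = coordinatesD[OF coords[OF n]] and \<kappa>m = coordinatesD[OF coords[OF m]]
    and hD = ordered_surjD[OF h]
  have \<phi>: "\<kappa> n u (h ! i) \<in> carrier R" if "u \<in> carrier (F n)" "i < m" for u i
    using \<kappa>n(3) hD(3) that by simp
  show lin: "?g \<in> linear_maps R (F n) (F m)"
    unfolding pull_def list_encode_inverse
    by (rule coord_map_linear[OF module_F[OF n] module_F[OF m] coords[OF m]])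
      (use \<kappa>n(4,5) \<phi> hD(3) in auto)
  show g: "\<kappa> m (?g u) i = \<kappa> n u (h ! i)" if "u \<in> carrier (F n)" "i < m" for u i
    unfolding pull_def list_encode_inverse
    using coord_map(2)[where \<phi> = "\<lambda>u i. \<kappa> n u (h ! i)", OF coords[OF m] that(1) \<phi>] that by simp
  \<comment> \<open>A section of the surjection \<open>h\<close>. Reading coordinates at the
    positions \<open>p a\<close> undoes the pullback, so \<open>?s\<close> below is a left
    inverse.\<close>
  obtain p where p: "\<And>a. a < n \<Longrightarrow> p a < m" "\<And>a. a < n \<Longrightarrow> h ! p a = a"
    using hD(5) by metis
  let ?s = "coord_map (F m) (F n) n (\<kappa> n) (\<lambda>v a. \<kappa> m v (p a))"
  have \<psi>: "\<kappa> m v (p a) \<in> carrier R" if "v \<in> carrier (F m)" "a < n" for v a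
    using \<kappa>m(3) p(1) that by simp
  have s: "?s \<in> linear_maps R (F m) (F n)"
    by (rule coord_map_linear[OF module_F[OF m] module_F[OF n] coords[OF n]])
      (use \<kappa>m(4,5) \<psi> p(1) in auto)
  note sD = coord_map[where \<phi> = "\<lambda>v a. \<kappa> m v (p a)" and M = "F m", OF coords[OF n] _ \<psi>]
  have "?s (?g u) = u" if u: "u \<in> carrier (F n)" for u
  proof (rule coordinates_eqI[OF coords[OF n]])
    have gu: "?g u \<in> carrier (F m)" by (rule linear_mapsD(2)[OF lin u])
    show "?s (?g u) \<in> carrier (F n)" using gu by (rule sD(1)) (use gu in auto)
    show "\<kappa> n (?s (?g u)) a = \<kappa> n u a" if "a < n" for a
      using sD(2)[OF gu gu _ that] g[OF u p(1)[OF that]] p(2)[OF that] by simp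
  qed (rule u)
  from left_invertible_splittable[OF module_F[OF n] module_F[OF m] lin s this]
  show "?g \<in> splittable_maps R (F n) (F m)" "inj_on ?g (carrier (F n))" by auto
qed

lemma functor_pull: "is_functor (OS_op A) (split_cat q R) F pull"
  unfolding is_functor_def
proof (intro conjI ballI)
  show "F n \<in> Ob (split_cat q R)" if "n \<in> Ob (OS_op A)" for n
    using that coordinates_imp_free[OF module_F coords] by simp
  show "pull n m c \<in> Mor (split_cat q R) (F n) (F m)"
    if "n \<in> Ob (OS_op A)" "m \<in> Ob (OS_op A)" "c \<in> Mor (OS_op A) n m" for n m c
    using that pull_splittable pull_inj by auto
next
  fix n assume "n \<in> Ob (OS_op A)"
  then have n: "n \<in> A" by simp
  let ?p = "pull n n (list_encode [0..<n])"
  note lin = pull_linear[OF n n ordered_surj_id] and co = pull_coords[OF n n ordered_surj_id]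
  have "?p u = u" if "u \<in> carrier (F n)" for u
    by (rule coordinates_eqI[OF coords[OF n]])
      (use that linear_mapsD(2)[OF lin that] in \<open>simp_all add: co\<close>)
  then have "?p = restrict id (carrier (F n))"
    using linear_mapsD(1)[OF lin] by (intro extensionalityI[where A = "carrier (F n)"]) (auto simp: PiE_def)
  then show "pull n n (Idm (OS_op A) n) = Idm (split_cat q R) (F n)" by simp
next
  fix n m k c d
  assume "n \<in> Ob (OS_op A)" "m \<in> Ob (OS_op A)" "k \<in> Ob (OS_op A)"
    and cd: "c \<in> Mor (OS_op A) n m" "d \<in> Mor (OS_op A) m k"
  then have n: "n \<in> A" and m: "m \<in> A" and k: "k \<in> A" by simp_all
  obtain f h where c: "c = list_encode f" and d: "d = list_encode h"
    and f: "f \<in> ordered_surj n m" and h: "h \<in> ordered_surj m k"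
    using cd by auto
  let ?fh = "map ((!) f) h"
  note fh = ordered_surj_compose[OF f h]
  note lin = pull_linear[OF n m f] pull_linear[OF m k h] pull_linear[OF n k fh]
  have "pull n k (list_encode ?fh) = compose (carrier (F n)) (pull m k d) (pull n m c)"
  proof (rule extensionalityI[where A = "carrier (F n)"])
    fix u assume u: "u \<in> carrier (F n)"
    have fu: "pull n m c u \<in> carrier (F m)" unfolding c by (rule linear_mapsD(2)[OF lin(1) u])
    show "pull n k (list_encode ?fh) u = compose (carrier (F n)) (pull m k d) (pull n m c) u"
      unfolding compose_eq[OF u]
    proof (rule coordinates_eqI[OF coords[OF k]])
      show "pull n k (list_encode ?fh) u \<in> carrier (F k)" by (rule linear_mapsD(2)[OF lin(3) u])
      show "pull m k d (pull n m c u) \<in> carrier (F k)"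
        unfolding d by (rule linear_mapsD(2)[OF lin(2) fu])
      show "\<kappa> k (pull n k (list_encode ?fh) u) i = \<kappa> k (pull m k d (pull n m c u)) i" if "i < k" for i
        using pull_coords[OF n k fh u that] pull_coords[OF m k h fu that]
          pull_coords[OF n m f u, of "h ! i"] ordered_surjD(1,3)[OF h] that
        by (simp add: c d)
    qed
  qed (use linear_mapsD(1)[OF lin(3)] in \<open>auto simp: PiE_def\<close>)
  then show "pull n k (Cmp (OS_op A) n m k d c) =
      Cmp (split_cat q R) (F n) (F m) (F k) (pull m k d) (pull n m c)"
    by (simp add: c d)
qed

text \<open>The coordinates of a linear map from \<open>U\<close> to \<open>F z\<close> are \<open>z\<close> linear forms on the finite set \<open>U\<close>;
  listing the distinct ones in order of appearance gives the factorization.\<close>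

lemma pull_factorization:
  assumes U: "module R U" and finU: "finite (carrier U)" and finR: "finite (carrier R)"
    and down: "\<forall>n \<in> A. \<forall>m \<le> n. m \<in> A"
    and z: "z \<in> A" and f: "f \<in> Mor (split_cat q R) U (F z)"
  shows "\<exists>k \<in> A. k \<le> card (carrier U \<rightarrow>\<^sub>E carrier R) \<and>
    (\<exists>f' \<in> Mor (split_cat q R) U (F k). \<exists>c \<in> Mor (OS_op A) k z.
      f = compose (carrier U) (pull k z c) f')"
proof -
  have fs: "f \<in> splittable_maps R U (F z)" and inj: "q \<Longrightarrow> inj_on f (carrier U)"
    using f by auto
  then have lin: "f \<in> linear_maps R U (F z)" by (simp add: splittable_maps_def)
  note fD = linear_mapsD[OF lin] and \<kappa>z = coordinatesD[OF coords[OF z]]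
  interpret U: module R U by fact
  let ?W = "carrier U \<rightarrow>\<^sub>E carrier R"
  \<comment> \<open>The linear forms are restricted to \<open>carrier U\<close> so that equal forms
    are equal functions and all of them lie in the finite set \<open>?W\<close>.\<close>
  define \<rho> where "\<rho> p = (\<lambda>u \<in> carrier U. \<kappa> z (f u) p)" for p
  obtain k h r where h: "h \<in> ordered_surj k z" and r: "inj_on r {..<k}"
    and \<rho>r: "\<And>p. p < z \<Longrightarrow> \<rho> p = r (h ! p)"
    using ordered_surj_factorization[of z \<rho>] by blast
  note hD = ordered_surjD[OF h]
  have form: "\<exists>p<z. r a = \<rho> p" if "a < k" for a
    using hD(5)[OF that] \<rho>r by metis
  have \<rho>W: "\<rho> p \<in> ?W" if "p < z" for p
    using \<kappa>z(3)[OF fD(2)] that by (simp add: \<rho>_def restrict_PiE_iff)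
  \<comment> \<open>The \<open>k\<close> letters are distinct elements of \<open>?W\<close>, so the
    bound on \<open>k\<close> depends on \<open>U\<close> and \<open>R\<close> but not on
    \<open>z\<close>.\<close>
  have "r ` {..<k} \<subseteq> ?W"
    using form \<rho>W by (metis image_subsetI lessThan_iff)
  then have "card {..<k} \<le> card ?W"
    by (rule card_inj_on_le[OF r]) (rule finite_PiE[OF finU finR])
  then have k_le: "k \<le> card ?W" by simp
  have k: "k \<in> A" using down z ordered_surj_le[OF h] by blast
  let ?f = "coord_map U (F k) k (\<kappa> k) (\<lambda>u i. r i u)"
  have r_closed: "r i u \<in> carrier R" if "u \<in> carrier U" "i < k" for u i
    using form[OF that(2)] \<rho>W that(1) by (metis PiE_mem)
  \<comment> \<open>Each letter \<open>r i\<close> is one of the forms \<open>\<rho> p\<close> and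
    inherits linearity from it.\<close>
  have r_add: "r i (u \<oplus>\<^bsub>U\<^esub> v) = r i u \<oplus>\<^bsub>R\<^esub> r i v"
    if u: "u \<in> carrier U" and v: "v \<in> carrier U" and i: "i < k" for u v i
  proof -
    obtain p where "p < z" "r i = \<rho> p" using form[OF i] by blast
    then show ?thesis using u v by (simp add: \<rho>_def fD \<kappa>z(4))
  qed
  have r_smult: "r i (a \<odot>\<^bsub>U\<^esub> v) = a \<otimes>\<^bsub>R\<^esub> r i v"
    if a: "a \<in> carrier R" and v: "v \<in> carrier U" and i: "i < k" for a v i
  proof -
    obtain p where "p < z" "r i = \<rho> p" using form[OF i] by blast
    then show ?thesis using a v by (simp add: \<rho>_def fD \<kappa>z(5))
  qed
  have f': "?f \<in> linear_maps R U (F k)"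
    by (rule coord_map_linear[OF U module_F[OF k] coords[OF k]])
      (simp_all add: r_closed r_add r_smult)
  note f'_coords = coord_map(2)[where \<phi> = "\<lambda>u i. r i u" and M = U, OF coords[OF k] _ r_closed]
  let ?g = "pull k z (list_encode h)"
  have eq: "?g (?f u) = f u" if u: "u \<in> carrier U" for u
  proof (rule coordinates_eqI[OF coords[OF z]])
    have fu: "?f u \<in> carrier (F k)" by (rule linear_mapsD(2)[OF f' u])
    show "?g (?f u) \<in> carrier (F z)" by (rule linear_mapsD(2)[OF pull_linear[OF k z h] fu])
    show "\<kappa> z (?g (?f u)) p = \<kappa> z (f u) p" if p: "p < z" for p
    proof -
      have "\<kappa> z (?g (?f u)) p = \<kappa> k (?f u) (h ! p)" by (rule pull_coords[OF k z h fu p])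
      also have "\<dots> = r (h ! p) u" using u hD(3)[OF p] by (intro f'_coords)
      also have "\<dots> = \<kappa> z (f u) p" using \<rho>r[OF p, symmetric] u by (simp add: \<rho>_def)
      finally show ?thesis .
    qed
  qed (rule fD(2)[OF u])
  then have comp: "f = compose (carrier U) ?g ?f"
    using fD(1) by (intro extensionalityI[where A = "carrier U"]) (auto simp: compose_eq PiE_def)
  \<comment> \<open>The composite with the injective pullback is the splittable map
    \<open>f\<close>, so splittability descends to \<open>?f\<close>.\<close>
  have "?f \<in> splittable_maps R U (F k)"
    by (rule splittable_factor[OF U module_F[OF k] module_F[OF z] f' pull_linear[OF k z h]
      pull_inj[OF k z h]]) (use fs comp in simp)
  moreover have "inj_on ?f (carrier U)" if q
  proof (rule inj_onI)
    fix u v assume "u \<in> carrier U" "v \<in> carrier U" "?f u = ?f v"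
    then show "u = v" using inj_onD[OF inj[OF that]] eq by metis
  qed
  ultimately have "?f \<in> Mor (split_cat q R) U (F k)" by simp
  moreover have "list_encode h \<in> Mor (OS_op A) k z" using h by simp
  ultimately show ?thesis using k k_le comp by blast
qed

text \<open>As the bound on \<open>k\<close> depends only on \<open>U\<close> and \<open>R\<close>,
  the finite set \<open>P\<close> of all morphisms from \<open>U\<close> to an \<open>F k\<close>
  within that bound serves every target at once.\<close>

lemma property_F_pull:
  assumes finR: "finite (carrier R)" and down: "\<forall>n \<in> A. \<forall>m \<le> n. m \<in> A"
  shows "property_F (OS_op A) (split_cat q R) F pull"
  unfolding property_F_def
proof
  fix U :: "('a, 'b) module" assume "U \<in> Ob (split_cat q R)"
  then have free: "free_finite_rank R U" by simp
  then have U: "module R U" by (simp add: free_finite_rank_def)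
  obtain n \<nu> where "coordinates R U n \<nu>" using free_imp_coordinates[OF free] by blast
  then have finU: "finite (carrier U)" by (rule finite_carrier_coordinates[OF finR])
  define P where "P = (SIGMA k : {k \<in> A. k \<le> card (carrier U \<rightarrow>\<^sub>E carrier R)}.
    Mor (split_cat q R) U (F k))"
  have "finite (Mor (split_cat q R) U (F k))" if "k \<in> A" for k
  proof (rule finite_subset)
    show "Mor (split_cat q R) U (F k) \<subseteq> carrier U \<rightarrow>\<^sub>E carrier (F k)"
      by (auto simp: splittable_maps_def linear_maps_def)
    show "finite (carrier U \<rightarrow>\<^sub>E carrier (F k))"
      using finU finite_carrier_coordinates[OF finR coords[OF that]] by (rule finite_PiE)
  qed
  then have "finite P" unfolding P_def by (intro finite_SigmaI) auto
  then obtain e :: "nat \<Rightarrow> _" where e: "bij_betw e {0..<card P} P"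
    using ex_bij_betw_nat_finite by blast
  have eP: "e i \<in> P" if "i < card P" for i using bij_betw_apply[OF e] that by simp
  have e_surj: "\<exists>i<card P. e i = p" if "p \<in> P" for p
    using bij_betw_imp_surj_on[OF e] that by (metis atLeastLessThan_iff imageE)
  show "\<exists>(n :: nat) ys fs. (\<forall>i<n. ys i \<in> Ob (OS_op A) \<and> fs i \<in> Mor (split_cat q R) U (F (ys i))) \<and>
     (\<forall>y \<in> Ob (OS_op A). \<forall>f \<in> Mor (split_cat q R) U (F y). \<exists>i<n. \<exists>g \<in> Mor (OS_op A) (ys i) y.
        f = Cmp (split_cat q R) U (F (ys i)) (F y) (pull (ys i) y g) (fs i))"
  proof (rule exI[of _ "card P"], rule exI[of _ "fst \<circ> e"], rule exI[of _ "snd \<circ> e"],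
      intro conjI allI impI ballI)
    fix i assume "i < card P"
    then show "(fst \<circ> e) i \<in> Ob (OS_op A)" "(snd \<circ> e) i \<in> Mor (split_cat q R) U (F ((fst \<circ> e) i))"
      using eP[of i] by (auto simp: P_def)
  next
    fix z f assume "z \<in> Ob (OS_op A)" and f: "f \<in> Mor (split_cat q R) U (F z)"
    then have z: "z \<in> A" by simp
    from pull_factorization[OF U finU finR down z f]
    obtain k f' c where "(k, f') \<in> P" and c: "c \<in> Mor (OS_op A) k z"
      and feq: "f = compose (carrier U) (pull k z c) f'"
      unfolding P_def by blast
    then obtain i where "i < card P" "e i = (k, f')" using e_surj by blast
    then show "\<exists>i<card P. \<exists>g \<in> Mor (OS_op A) ((fst \<circ> e) i) z.
        f = Cmp (split_cat q R) U (F ((fst \<circ> e) i)) (F z) (pull ((fst \<circ> e) i) z g) ((snd \<circ> e) i)"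
      using c feq by (intro exI[of _ i] conjI bexI[of _ c]) simp_all
  qed
qed

end

text \<open>One module \<open>F n\<close> is chosen for each realized rank. Every object has some
  coordinates and is thus isomorphic to a chosen module, which gives essential surjectivity.\<close>

theorem quasi_groebner_split_cat:
  fixes R :: "('a, 'r) ring_scheme"
  assumes "finite (carrier R)"
  shows "quasi_groebner TYPE(nat) TYPE(nat) (split_cat q R :: (('a, 'b) module, 'b \<Rightarrow> 'b) cat)"
proof -
  \<comment> \<open>If \<open>'b\<close> is finite, only finitely many ranks are realized by modules with elements in \<open>'b\<close>.\<close>
  define A where "A = {n. \<exists>(M :: ('a, 'b) module) \<kappa>. module R M \<and> coordinates R M n \<kappa>}"
  have "\<forall>n \<in> A. \<exists>(M :: ('a, 'b) module) \<kappa>. module R M \<and> coordinates R M n \<kappa>"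
    by (simp add: A_def)
  then obtain F :: "nat \<Rightarrow> ('a, 'b) module" and \<kappa>
    where F: "\<forall>n \<in> A. module R (F n) \<and> coordinates R (F n) n (\<kappa> n)"
    by metis
  interpret coordinate_family R A F \<kappa>
    using F by (intro coordinate_family.intro) auto
  have down: "\<forall>n \<in> A. \<forall>m \<le> n. m \<in> A"
    using coordinates_smaller unfolding A_def by blast
  have "essentially_surjective (OS_op A) (split_cat q R) F"
    unfolding essentially_surjective_def
  proof
    fix M :: "('a, 'b) module" assume "M \<in> Ob (split_cat q R)"
    then have free: "free_finite_rank R M" by simp
    then have M: "module R M" by (simp add: free_finite_rank_def)
    obtain n \<nu> where \<nu>: "coordinates R M n \<nu>" using free_imp_coordinates[OF free] by blast
    then have n: "n \<in> A" using M unfolding A_def by blast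
    have "iso_objects (split_cat q R) M (F n)"
      by (rule iso_objects_coordinates[OF M module_F[OF n] \<nu> coords[OF n]])
    then show "\<exists>n \<in> Ob (OS_op A). iso_objects (split_cat q R) M (F n)" using n by auto
  qed
  then show ?thesis
    unfolding quasi_groebner_def
    by (intro exI[of _ "OS_op A"] exI[of _ F] exI[of _ pull] conjI groebner_OS_op functor_pull
      property_F_pull[OF assms down])
qed

theorem theorem8p3p1:
  fixes R :: "('a, 'r) ring_scheme"
  assumes "cring R" and "finite (carrier R)"
  shows "quasi_groebner TYPE(nat) TYPE(nat) (VI R :: (('a, 'b) module, 'b \<Rightarrow> 'b) cat) \<and>
         quasi_groebner TYPE(nat) TYPE(nat) (VA R :: (('a, 'b) module, 'b \<Rightarrow> 'b) cat)"
  unfolding VI_eq_split_cat VA_eq_split_cat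
  using quasi_groebner_split_cat[OF assms(2)] by blast

end
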